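(* Let $S(n)$ be the maximum size of a Sidon subset $A\subseteq\{1,\dots,n\}$ such that there are no pairwise distinct $x_1,\dots,x_5\in A$ with $x_1+x_2+x_3+x_4=4x_5$. Then $S(n)=o(\sqrt n)$ and $S(n)\ge n^{1/2-o(1)}$; that is, $S(n)/\sqrt n\to 0$, and for every $\varepsilon>0$ we have $S(n)\ge n^{1/2-\varepsilon}$ for all sufficiently large $n$.
   Context: A set $A$ of integers is a Sidon set if it has no nontrivial solution to $x_1+x_2=x_3+x_4$ with $x_i\in A$, where a solution is trivial if $\{x_1,x_2\}=\{x_3,x_4\}$ (i.e. $(x_1,x_2)=(x_3,x_4)$ or $(x_4,x_3)$). *)

theory Defs
  imports Complex_Main
begin

definition sidon :: "int set \<Rightarrow> bool" where
  "sidon A \<longleftrightarrow> (\<forall>x1\<in>A. \<forall>x2\<in>A. \<forall>x3\<in>A. \<forall>x4\<in>A.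
      x1 + x2 = x3 + x4 \<longrightarrow> {x1, x2} = {x3, x4})"

definition no_four_avg :: "int set \<Rightarrow> bool" where
  "no_four_avg A \<longleftrightarrow> \<not> (\<exists>x1\<in>A. \<exists>x2\<in>A. \<exists>x3\<in>A. \<exists>x4\<in>A. \<exists>x5\<in>A.
      distinct [x1, x2, x3, x4, x5] \<and> x1 + x2 + x3 + x4 = 4 * x5)"

definition S :: "nat \<Rightarrow> nat" where
  "S n = Max (card ` {A. A \<subseteq> {1..int n} \<and> sidon A \<and> no_four_avg A})"

end

theory Submission
  imports
    Defs
    "HOL-Library.FuncSet"
    "HOL-Number_Theory.Number_Theory"
    "HOL-Analysis.Convex"
    "HOL-Real_Asymp.Real_Asymp"
begin

text \<open>
  Upper bound. View \<open>A\<close> inside the cyclic group of order \<open>N = 4 * n + 1\<close>. Two consequences of the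
  Sidon property carry the proof: the fourth moment of the Fourier transform of \<open>A\<close> is as small as
  that of a dense set, so the spectrum of \<open>A\<close> at level \<open>e\<close> has boundedly many elements; and
  the average of \<open>A\<close> over translates of any dense set \<open>B\<close> is bounded in \<open>L\<^sup>2\<close>. Smoothing \<open>A\<close>
  over the Bohr set of a fine spectrum changes the number of solutions only slightly. The energy on the
  spectra of a rapidly decreasing sequence of levels is bounded, so it hardly grows between some two
  levels; the smoothed function is then almost invariant under the Bohr set of the coarser level, and
  translation invariance of the equation yields \<open>c * N powr (3/2)\<close> solutions near the diagonal.
  A Sidon set has only \<open>O(N)\<close> solutions with two equal entries.

  Lower bound. Restrict the Erdos--Turan Sidon set \<open>{(k, k\<^sup>2 mod p)}\<close> to those \<open>k\<close> that lie in a
  Behrend-type set without nontrivial solutions, which has size \<open>p powr (1 - o(1))\<close>; a weak form of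
  Chebyshev's estimate supplies a suitable prime \<open>p\<close>.
\<close>

section \<open>Fourier analysis on a cyclic group\<close>

text \<open>The obstacle is sparsity: \<open>A\<close> has about \<open>sqrt N\<close> elements, so
  arguments for sets of positive density do not apply, and Parseval bounds its Fourier energy only
  by \<open>N * card A\<close>. Averaging over at least \<open>card A\<close> translates brings the
  energy down to order \<open>N\<close>, as for a dense function. Three levels are in play. The
  smoothing level \<open>e1\<close> must be small compared with the density of the Bohr set at the
  coarse level \<open>e0\<close>, because the number of solutions found depends on that density.
  Almost invariance under this Bohr set, however, requires control of every frequency outside the
  coarse spectrum. A third level \<open>e2\<close>, small compared with the density of the Bohr set
  at \<open>e1\<close>, splits these frequencies: outside the spectrum at \<open>e2\<close> the
  smoothing makes them negligible, the others are covered by the small growth of energy. The power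
  \<open>N powr (3/2)\<close> is the expected one: about \<open>N ^ 3\<close> triples of offsets,
  about \<open>N\<close> base points for each, and five values of order \<open>1 / sqrt N\<close>.
  The modulus \<open>4 * n + 1\<close> is odd, which makes 4 invertible, and large enough that the
  equation does not wrap around.\<close>

locale cyclic =
  fixes N :: int
  assumes N_pos: "0 < N"
begin

abbreviation I :: "int set" where "I \<equiv> {0..<N}"

definition ec :: "int \<Rightarrow> complex" where
  "ec x = cis (2 * pi * of_int x / of_int N)"

text \<open>Functions on the cyclic group are encoded as periodic functions on the integers, with
  \<open>I\<close> as set of representatives. Arguments such as \<open>x - y\<close> or
  \<open>4 * x\<close> then need no reduction, at the price of periodicity side conditions.\<close>

definition periodic :: "(int \<Rightarrow> 'a) \<Rightarrow> bool" where
  "periodic f \<longleftrightarrow> (\<forall>x. f (x mod N) = f x)"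

definition ft :: "(int \<Rightarrow> real) \<Rightarrow> int \<Rightarrow> complex" where
  "ft f k = (\<Sum>x\<in>I. of_real (f x) * ec (k * x))"

definition conv :: "(int \<Rightarrow> real) \<Rightarrow> (int \<Rightarrow> real) \<Rightarrow> int \<Rightarrow> real" where
  "conv f g x = (\<Sum>y\<in>I. f y * g (x - y))"

lemma ec_0 [simp]: "ec 0 = 1"
  by (simp add: ec_def)

lemma ec_add: "ec (x + y) = ec x * ec y"
  by (simp add: ec_def cis_mult add_divide_distrib distrib_left)

lemma ec_minus: "ec (- x) = cnj (ec x)"
  by (simp add: ec_def cis_cnj)

lemma norm_ec [simp]: "norm (ec x) = 1"
  by (simp add: ec_def)

lemma ec_period: "ec (N * k) = 1"
proof -
  have "2 * pi * of_int (N * k) / of_int N = 2 * pi * of_int k"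
    using N_pos by simp
  then show ?thesis
    by (simp add: ec_def complex_eq_iff mult.commute mult.left_commute)
       (metis cos_int_2pin sin_int_2pin mult.commute mult.left_commute)
qed

lemma ec_mod: "ec (x mod N) = ec x"
proof -
  have "ec x = ec (N * (x div N) + x mod N)" by simp
  also have "\<dots> = ec (x mod N)" by (simp only: ec_add ec_period mult_1)
  finally show ?thesis by simp
qed

lemma ec_cong: "x mod N = y mod N \<Longrightarrow> ec x = ec y"
  by (metis ec_mod)

lemma ec_eq_1_iff: "ec x = 1 \<longleftrightarrow> N dvd x"
proof
  assume "ec x = 1"
  then have "cos (2 * pi * of_int x / of_int N) = 1"
    by (simp add: ec_def complex_eq_iff)
  then obtain k :: int where "2 * pi * of_int x / of_int N = of_int k * 2 * pi"
    by (auto simp: cos_one_2pi_int)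
  then have "of_int x = (of_int (k * N) :: real)"
    using N_pos by (simp add: field_simps)
  then show "N dvd x" by (metis dvd_triv_right of_int_eq_iff)
next
  assume "N dvd x"
  then show "ec x = 1" by (auto simp: ec_period)
qed

lemma periodicD: "periodic f \<Longrightarrow> x mod N = y mod N \<Longrightarrow> f x = f y"
  unfolding periodic_def by metis

text \<open>An affine map with invertible slope permutes the residues. Slope 1 gives translations;
  slope \<open>- 4\<close>, invertible for odd \<open>N\<close>, handles the frequencies
  \<open>- 4 * k\<close>.\<close>

lemma sum_affine:
  fixes f :: "int \<Rightarrow> 'b::comm_monoid_add"
  assumes f: "periodic f" and u: "coprime u N"
  shows "(\<Sum>x\<in>I. f (u * x + t)) = (\<Sum>x\<in>I. f x)"
proof -
  have inj: "inj_on (\<lambda>x. (u * x + t) mod N) I"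
  proof (rule inj_onI)
    fix x y assume xy: "x \<in> I" "y \<in> I" "(u * x + t) mod N = (u * y + t) mod N"
    then have "N dvd (u * x + t) - (u * y + t)" by (simp add: mod_eq_dvd_iff)
    then have "N dvd u * (x - y)" by (simp add: algebra_simps)
    then have "N dvd x - y" using u by (simp add: coprime_commute coprime_dvd_mult_right_iff)
    then have "x mod N = y mod N" by (simp add: mod_eq_dvd_iff)
    then show "x = y" using xy by simp
  qed
  have sub: "(\<lambda>x. (u * x + t) mod N) ` I \<subseteq> I" using N_pos by auto
  have eq: "(\<lambda>x. (u * x + t) mod N) ` I = I"
    by (rule endo_inj_surj[OF _ sub inj]) simp
  have "(\<Sum>x\<in>I. f x) = (\<Sum>x\<in>(\<lambda>x. (u * x + t) mod N) ` I. f x)" by (simp add: eq)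
  also have "\<dots> = (\<Sum>x\<in>I. f ((u * x + t) mod N))"
    by (subst sum.reindex[OF inj]) simp
  also have "\<dots> = (\<Sum>x\<in>I. f (u * x + t))"
    using f by (simp add: periodic_def)
  finally show ?thesis by simp
qed

lemma sum_shift:
  fixes f :: "int \<Rightarrow> 'b::comm_monoid_add"
  shows "periodic f \<Longrightarrow> (\<Sum>x\<in>I. f (x + t)) = (\<Sum>x\<in>I. f x)"
  using sum_affine[of f 1 t] by simp

text \<open>Replacing \<open>k\<close> by \<open>k + 1\<close> permutes the summands and multiplies
  the sum by \<open>ec y\<close>, so the sum vanishes unless \<open>ec y = 1\<close>.\<close>

lemma orthogonality: "(\<Sum>k\<in>I. ec (k * y)) = (if N dvd y then of_int N else 0)"
proof (cases "N dvd y")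
  case True
  then have "ec (k * y) = 1" for k by (simp add: ec_eq_1_iff)
  then show ?thesis using True N_pos by simp
next
  case False
  have per: "periodic (\<lambda>k. ec (k * y))"
    unfolding periodic_def by (auto intro!: ec_cong simp: mod_mult_left_eq)
  have "(\<Sum>k\<in>I. ec (k * y)) * ec y = (\<Sum>k\<in>I. ec ((k + 1) * y))"
    by (simp add: sum_distrib_right ec_add distrib_right)
  also have "\<dots> = (\<Sum>k\<in>I. ec (k * y))" using sum_shift[OF per, of 1] by simp
  finally have "(\<Sum>k\<in>I. ec (k * y)) * (ec y - 1) = 0" by (simp add: algebra_simps)
  then show ?thesis using False by (simp add: ec_eq_1_iff)
qed

lemma fourier_inversion:
  assumes f: "periodic f"
  shows "(\<Sum>k\<in>I. ft f k * ec (- (k * y))) = of_int N * of_real (f y)"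
proof -
  have "(\<Sum>k\<in>I. ft f k * ec (- (k * y))) = (\<Sum>k\<in>I. \<Sum>x\<in>I. of_real (f x) * ec (k * (x - y)))"
    by (simp add: ft_def sum_distrib_right mult.assoc ec_add[symmetric] right_diff_distrib)
  also have "\<dots> = (\<Sum>x\<in>I. of_real (f x) * (\<Sum>k\<in>I. ec (k * (x - y))))"
    by (subst sum.swap) (simp add: sum_distrib_left)
  also have "\<dots> = (\<Sum>x\<in>I. if x = y mod N then of_real (f x) * of_int N else 0)"
  proof (rule sum.cong[OF refl])
    fix x assume "x \<in> I"
    then have "N dvd x - y \<longleftrightarrow> x = y mod N"
      by (auto simp: mod_eq_dvd_iff[symmetric])
    then show "of_real (f x) * (\<Sum>k\<in>I. ec (k * (x - y))) =
        (if x = y mod N then of_real (f x) * of_int N else (0::complex))"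
      by (simp add: orthogonality)
  qed
  also have "\<dots> = of_int N * of_real (f y)"
    using N_pos f by (simp add: periodic_def)
  finally show ?thesis .
qed

lemma parseval:
  assumes f: "periodic f"
  shows "(\<Sum>k\<in>I. (norm (ft f k))\<^sup>2) = of_int N * (\<Sum>x\<in>I. (f x)\<^sup>2)"
proof -
  have "of_real (\<Sum>k\<in>I. (norm (ft f k))\<^sup>2) = (\<Sum>k\<in>I. ft f k * cnj (ft f k))"
    by (simp only: of_real_sum complex_norm_square)
  also have "\<dots> = (\<Sum>k\<in>I. \<Sum>x\<in>I. of_real (f x) * (ft f k * ec (- (k * x))))"
    by (simp add: ft_def[of f] sum_distrib_left ec_minus mult.commute mult.left_commute)
  also have "\<dots> = (\<Sum>x\<in>I. of_real (f x) * (\<Sum>k\<in>I. ft f k * ec (- (k * x))))"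
    by (subst sum.swap) (simp add: sum_distrib_left)
  also have "\<dots> = (of_real (of_int N * (\<Sum>x\<in>I. (f x)\<^sup>2)) :: complex)"
    unfolding fourier_inversion[OF f] by (simp add: sum_distrib_left power2_eq_square mult_ac)
  finally show ?thesis by (simp only: of_real_eq_iff)
qed

lemma periodic_conv: "periodic g \<Longrightarrow> periodic (conv f g)"
  unfolding conv_def periodic_def
  by (intro allI sum.cong refl arg_cong2[where f="(*)"]) (metis mod_diff_left_eq)

lemma periodic_shift: "periodic f \<Longrightarrow> periodic (\<lambda>x. f (x + t))"
  unfolding periodic_def by (metis mod_add_left_eq)

lemma ft_shift:
  assumes f: "periodic f"
  shows "ft (\<lambda>x. f (x + t)) k = ec (- (k * t)) * ft f k"
proof -
  have per: "periodic (\<lambda>x. of_real (f x) * ec (k * (x - t)))"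
    unfolding periodic_def
  proof
    fix x
    have "ec (k * (x mod N - t)) = ec (k * (x - t))"
      by (rule ec_cong) (metis mod_diff_left_eq mod_mult_right_eq)
    then show "of_real (f (x mod N)) * ec (k * (x mod N - t)) = of_real (f x) * ec (k * (x - t))"
      using f by (simp add: periodic_def)
  qed
  have "ft (\<lambda>x. f (x + t)) k = (\<Sum>x\<in>I. of_real (f (x + t)) * ec (k * ((x + t) - t)))"
    by (simp add: ft_def)
  also have "\<dots> = (\<Sum>x\<in>I. of_real (f x) * ec (k * (x - t)))"
    by (rule sum_shift[OF per])
  also have "\<dots> = ec (- (k * t)) * ft f k"
  proof -
    have "ec (k * (x - t)) = ec (- (k * t)) * ec (k * x)" for x
      by (simp add: ec_add[symmetric] algebra_simps)
    then show ?thesis by (simp add: ft_def sum_distrib_left mult_ac)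
  qed
  finally show ?thesis .
qed

lemma ft_conv:
  assumes g: "periodic g"
  shows "ft (conv f g) k = ft f k * ft g k"
proof -
  have "ft (conv f g) k = (\<Sum>x\<in>I. \<Sum>y\<in>I. of_real (f y) * (of_real (g (x - y)) * ec (k * x)))"
    by (simp add: ft_def conv_def sum_distrib_right mult.assoc)
  also have "\<dots> = (\<Sum>y\<in>I. of_real (f y) * ft (\<lambda>x. g (x + - y)) k)"
    by (subst sum.swap) (simp add: sum_distrib_left ft_def)
  also have "\<dots> = ft f k * ft g k"
    by (simp add: ft_shift[OF g] ft_def[of f] sum_distrib_right mult.assoc
             del: add_uminus_conv_diff)
  finally show ?thesis .
qed

text \<open>The weighted number of solutions of \<open>x1 + x2 + x3 + x4 = 4 * x5\<close> in the
  cyclic group, those with equal entries included.\<close>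

definition count5 :: "(int \<Rightarrow> real) \<Rightarrow> real" where
  "count5 f = (\<Sum>x\<in>I. f x * conv (conv f f) (conv f f) (4 * x))"

text \<open>The fourfold convolution has transform \<open>ft f k ^ 4\<close>; inverting it at
  \<open>4 * x\<close> and summing against \<open>f x\<close> produces the frequency
  \<open>- 4 * k\<close>.\<close>

lemma count5_fourier:
  assumes f: "periodic f"
  shows "of_int N * of_real (count5 f) = (\<Sum>k\<in>I. ft f k ^ 4 * ft f (- 4 * k))"
proof -
  let ?R = "conv (conv f f) (conv f f)"
  have R: "periodic ?R" by (intro periodic_conv f)
  have "(\<Sum>k\<in>I. ft f k ^ 4 * ft f (- 4 * k)) =
      (\<Sum>k\<in>I. \<Sum>x\<in>I. of_real (f x) * (ft ?R k * ec (- (k * (4 * x)))))"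
    by (simp add: ft_conv f periodic_conv ft_def[of f "_ * _"] ft_def[of f "- _"] sum_distrib_left power4_eq_xxxx mult_ac)
  also have "\<dots> = (\<Sum>x\<in>I. of_real (f x) * (\<Sum>k\<in>I. ft ?R k * ec (- (k * (4 * x)))))"
    by (subst sum.swap) (simp add: sum_distrib_left)
  also have "\<dots> = of_int N * of_real (count5 f)"
    unfolding fourier_inversion[OF R] count5_def by (simp add: sum_distrib_left mult_ac)
  finally show ?thesis by simp
qed

text \<open>Translation invariance of the equation in coordinates: the four summands are measured
  from \<open>z\<close>, and as they add up to \<open>4 * z\<close>, their offsets add up to 0. Each
  change of variable is a shift, allowed by periodicity.\<close>

lemma conv4_diagonal:
  assumes f: "periodic f"
  shows "conv (conv f f) (conv f f) (4 * z) =
    (\<Sum>r\<in>I. \<Sum>s\<in>I. \<Sum>t\<in>I. f (z + r) * f (z + s) * f (z + t) * f (z - r - s - t))"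
proof -
  have p1: "periodic (\<lambda>v. f v * g (w - v))" if "periodic g" for g :: "int \<Rightarrow> real" and w
    using f that unfolding periodic_def by (metis mod_diff_right_eq)
  have c: "conv f f w = (\<Sum>s\<in>I. f (z + s) * f (w - z - s))" for w
    using sum_shift[OF p1[OF f, of w], of z] by (simp add: conv_def algebra_simps)
  have p2: "periodic (\<lambda>u. conv f f (4 * z - u))"
    using periodic_conv[OF f, of f] unfolding periodic_def by (metis mod_diff_right_eq)
  have p3: "periodic (\<lambda>u. f (u - y) * conv f f (4 * z - u))" for y
    using p2 f unfolding periodic_def by (metis mod_diff_left_eq)
  have p4: "periodic (\<lambda>v. f v * (\<Sum>s\<in>I. f (z + s) * conv f f (3 * z - s - v)))"
  proof (unfold periodic_def, intro allI)
    fix v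
    have "conv f f (3 * z - s - v mod N) = conv f f (3 * z - s - v)" for s
      by (rule periodicD[OF periodic_conv[OF f]]) (metis mod_diff_right_eq)
    then show "f (v mod N) * (\<Sum>s\<in>I. f (z + s) * conv f f (3 * z - s - v mod N)) =
       f v * (\<Sum>s\<in>I. f (z + s) * conv f f (3 * z - s - v))"
      using f by (simp add: periodic_def)
  qed
  have "conv (conv f f) (conv f f) (4 * z) =
      (\<Sum>u\<in>I. \<Sum>v\<in>I. f v * (f (u - v) * conv f f (4 * z - u)))"
    by (simp add: conv_def[of "conv f f"] conv_def[of f f "_::int"] sum_distrib_right mult.assoc)
  also have "\<dots> = (\<Sum>v\<in>I. f v * (\<Sum>u\<in>I. f (u - v) * conv f f (4 * z - u)))"
    by (subst sum.swap) (simp add: sum_distrib_left)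
  also have "\<dots> = (\<Sum>v\<in>I. f v * (\<Sum>s\<in>I. f (z + s) * conv f f (3 * z - s - v)))"
  proof (rule sum.cong[OF refl], rule arg_cong2[where f="(*)", OF refl])
    fix v
    show "(\<Sum>u\<in>I. f (u - v) * conv f f (4 * z - u)) =
       (\<Sum>s\<in>I. f (z + s) * conv f f (3 * z - s - v))"
      using sum_shift[OF p3[of v], of "v + z"] by (simp add: algebra_simps)
  qed
  also have "\<dots> = (\<Sum>r\<in>I. f (z + r) * (\<Sum>s\<in>I. f (z + s) * conv f f (2 * z - s - r)))"
    using sum_shift[OF p4, of z] by (simp add: algebra_simps)
  also have "\<dots> = (\<Sum>r\<in>I. \<Sum>s\<in>I. \<Sum>t\<in>I. f (z + r) * f (z + s) * f (z + t) * f (z - r - s - t))"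
    by (simp add: c sum_distrib_left mult.assoc) (simp add: algebra_simps)
  finally show ?thesis .
qed

end

section \<open>Bohr sets and Sidon sets modulo \<open>N\<close>\<close>

lemma norm_cis_minus_1_le: "norm (cis x - 1) \<le> \<bar>x\<bar>"
proof -
  have "(norm (cis x - 1))\<^sup>2 = (cos x - 1)\<^sup>2 + (sin x)\<^sup>2"
    by (simp add: cmod_power2)
  also have "\<dots> = 2 - 2 * cos x"
    using sin_cos_squared_add[of x] by (simp add: power2_eq_square algebra_simps)
  also have "\<dots> = (2 * sin (x / 2))\<^sup>2"
    using cos_double_sin[of "x / 2"] by (simp add: power_mult_distrib)
  also have "\<dots> \<le> x\<^sup>2"
    using abs_sin_x_le_abs_x[of "x / 2"] by (intro iffD1[OF abs_le_square_iff]) simp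
  finally show ?thesis using abs_le_square_iff[of "norm (cis x - 1)" x] by simp
qed

context cyclic
begin

lemma norm_ec_minus_1_le: "norm (ec x - 1) \<le> 2 * pi * \<bar>of_int x\<bar> / of_int N"
  using norm_cis_minus_1_le[of "2 * pi * of_int x / of_int N"] N_pos
  by (simp add: ec_def abs_mult)

definition bohr :: "int set \<Rightarrow> real \<Rightarrow> int set" where
  "bohr K r = {t \<in> I. \<forall>k\<in>K. norm (ec (k * t) - 1) \<le> r}"

lemma bohr_subset: "bohr K r \<subseteq> I"
  by (auto simp: bohr_def)

lemma finite_bohr [simp]: "finite (bohr K r)"
  using bohr_subset finite_subset by blast

text \<open>Pigeonhole on a torus: for each \<open>k\<close> in \<open>K\<close>, record in which of
  \<open>m\<close> equal arcs \<open>k * t\<close> falls. Some cell holds a proportion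
  \<open>1 / m ^ card K\<close> of the group, and differences within a cell lie in the Bohr
  set.\<close>

lemma card_bohr_ge:
  assumes K: "finite K" and m: "0 < (m::nat)"
  shows "of_int N \<le> real (card (bohr K (2 * pi / real m))) * real m ^ card K"
proof -
  define cell where "cell t = (\<lambda>k\<in>K. ((k * t) mod N) * int m div N)" for t
  let ?C = "K \<rightarrow>\<^sub>E {0..<int m}"
  have range: "cell \<in> I \<rightarrow> ?C"
  proof
    fix t assume "t \<in> I"
    have "(k * t) mod N * int m div N < int m" for k
    proof -
      have "(k * t) mod N * int m < N * int m" using N_pos m by simp
      moreover have "N * ((k * t) mod N * int m div N) \<le> (k * t) mod N * int m"
        using N_pos mult_div_mod_eq[of N "(k * t) mod N * int m"]
          pos_mod_sign[of N "(k * t) mod N * int m"] by linarith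
      ultimately have "N * ((k * t) mod N * int m div N) < N * int m" by linarith
      then show ?thesis using N_pos by simp
    qed
    moreover have "0 \<le> (k * t) mod N * int m div N" for k
      using N_pos by (simp add: pos_imp_zdiv_nonneg_iff)
    ultimately show "cell t \<in> ?C" by (auto simp: cell_def)
  qed
  have fin: "finite ?C" using K by (simp add: finite_PiE)
  have ne: "?C \<noteq> {}" using m by (auto simp: PiE_eq_empty_iff)
  obtain c where c: "card (cell -` {c} \<inter> I) * card ?C \<ge> card I"
    using pigeonhole_card[OF range _ fin ne] by auto
  have cardC: "card ?C = m ^ card K" using K by (simp add: card_PiE)
  let ?F = "cell -` {c} \<inter> I"
  \<comment> \<open>Subtracting one fixed element of the cell keeps the map injective, so nothing is
    lost in the count.\<close>
  have "?F \<noteq> {}" using c N_pos by (intro notI) simp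
  then obtain t0 where t0: "t0 \<in> I" "cell t0 = c" by blast
  have inj: "inj_on (\<lambda>t. (t - t0) mod N) ?F"
  proof (rule inj_onI)
    fix x y assume xy: "x \<in> ?F" "y \<in> ?F" "(x - t0) mod N = (y - t0) mod N"
    have "x mod N = y mod N" using xy(3) by (simp add: mod_eq_dvd_iff)
    moreover have "x mod N = x" "y mod N = y" using xy(1,2) by auto
    ultimately show "x = y" by simp
  qed
  have "(\<lambda>t. (t - t0) mod N) ` ?F \<subseteq> bohr K (2 * pi / real m)"
  proof
    fix s assume "s \<in> (\<lambda>t. (t - t0) mod N) ` ?F"
    then obtain t where t: "t \<in> I" "cell t = c" "s = (t - t0) mod N" by auto
    have "norm (ec (k * s) - 1) \<le> 2 * pi / real m" if k: "k \<in> K" for k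
    proof -
      let ?u = "(k * t) mod N" and ?v = "(k * t0) mod N"
      have "cell t k = cell t0 k" using t t0 by simp
      then have "?u * int m div N = ?v * int m div N" using k by (simp add: cell_def)
      then have "?u * int m - ?v * int m = ?u * int m mod N - ?v * int m mod N"
        by (metis add_diff_cancel_left mult_div_mod_eq)
      moreover have "0 \<le> ?u * int m mod N" "?u * int m mod N < N"
        "0 \<le> ?v * int m mod N" "?v * int m mod N < N" using N_pos by auto
      ultimately have "\<bar>?u * int m - ?v * int m\<bar> \<le> N" by linarith
      moreover have "\<bar>?u - ?v\<bar> * int m = \<bar>?u * int m - ?v * int m\<bar>"
        unfolding left_diff_distrib[symmetric] by (simp only: abs_mult abs_of_nat)
      ultimately have "\<bar>?u - ?v\<bar> * int m \<le> N" by simp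
      then have *: "real_of_int \<bar>?u - ?v\<bar> * real m \<le> of_int N"
        by (metis of_int_le_iff of_int_mult of_int_of_nat_eq)
      have "ec (k * s) = ec (?u - ?v)"
        by (rule ec_cong) (simp add: t(3) mod_mult_right_eq mod_diff_eq right_diff_distrib)
      then have "norm (ec (k * s) - 1) \<le> 2 * pi * \<bar>of_int (?u - ?v)\<bar> / of_int N"
        using norm_ec_minus_1_le by metis
      also have "\<dots> \<le> 2 * pi / real m"
        using * m N_pos by (simp add: field_simps)
      finally show ?thesis .
    qed
    then show "s \<in> bohr K (2 * pi / real m)" using t(3) N_pos by (auto simp: bohr_def)
  qed
  then have "card ?F \<le> card (bohr K (2 * pi / real m))"
    by (metis card_image card_mono finite_bohr inj)
  then have "card I \<le> card (bohr K (2 * pi / real m)) * m ^ card K"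
    using c cardC by (metis le_trans mult_le_mono1)
  then have "real (card I) \<le> real (card (bohr K (2 * pi / real m)) * m ^ card K)"
    by (simp only: of_nat_le_iff)
  then show ?thesis using N_pos by simp
qed

lemma bohr_mono: "r \<le> s \<Longrightarrow> bohr K r \<subseteq> bohr K s"
  by (auto simp: bohr_def)

definition ind :: "int set \<Rightarrow> int \<Rightarrow> real" where
  "ind A x = (if x mod N \<in> A then 1 else 0)"

lemma ind_nonneg [simp]: "0 \<le> ind A x"
  by (simp add: ind_def)

lemma periodic_ind [simp]: "periodic (ind A)"
  by (simp add: periodic_def ind_def)

lemma sum_ind_mult:
  fixes g :: "int \<Rightarrow> 'a::real_algebra_1"
  assumes "A \<subseteq> I"
  shows "(\<Sum>x\<in>I. of_real (ind A x) * g x) = (\<Sum>x\<in>A. g x)"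
proof -
  have "(\<Sum>x\<in>I. of_real (ind A x) * g x) = (\<Sum>x\<in>I. if x \<in> A then g x else 0)"
    by (intro sum.cong) (auto simp: ind_def)
  also have "\<dots> = (\<Sum>x\<in>A. g x)"
    using assms by (simp add: sum.inter_restrict[symmetric] Int_absorb1)
  finally show ?thesis .
qed

lemma conv_ind: "A \<subseteq> I \<Longrightarrow> conv (ind A) g x = (\<Sum>y\<in>A. g (x - y))"
  using sum_ind_mult[of A "\<lambda>y. g (x - y)"] by (simp add: conv_def)

lemma ft_ind: "A \<subseteq> I \<Longrightarrow> ft (ind A) k = (\<Sum>x\<in>A. ec (k * x))"
  using sum_ind_mult[of A "\<lambda>x. ec (k * x)"] by (simp add: ft_def)

lemma sum_ind: "A \<subseteq> I \<Longrightarrow> (\<Sum>x\<in>I. ind A x) = card A"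
  using sum_ind_mult[of A "\<lambda>x. 1::real"] by simp

lemma ft_mod: "ft f (k mod N) = ft f k"
  unfolding ft_def by (intro sum.cong refl arg_cong2[where f="(*)"] ec_cong) (simp add: mod_mult_left_eq)

lemma norm_ft_ind_le: "A \<subseteq> I \<Longrightarrow> norm (ft (ind A) k) \<le> card A"
  using norm_sum[of "\<lambda>x. ec (k * x)" A] by (simp add: ft_ind)

section \<open>Representation counts, additive energy and differences of Sidon sets\<close>

definition sidon_mod :: "int set \<Rightarrow> bool" where
  "sidon_mod A \<longleftrightarrow> A \<subseteq> I \<and> (\<forall>x1\<in>A. \<forall>x2\<in>A. \<forall>x3\<in>A. \<forall>x4\<in>A.
      (x1 + x2) mod N = (x3 + x4) mod N \<longrightarrow> {x1, x2} = {x3, x4})"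

lemma sidon_modD:
  assumes "sidon_mod A" "x1 \<in> A" "x2 \<in> A" "x3 \<in> A" "x4 \<in> A" "(x1 + x2) mod N = (x3 + x4) mod N"
  shows "{x1, x2} = {x3, x4}"
  using assms unfolding sidon_mod_def by blast

text \<open>One representation of \<open>x\<close> as a sum determines the unordered pair, which
  leaves at most two choices of the first entry.\<close>

lemma conv_ind_le_2:
  assumes A: "sidon_mod A"
  shows "conv (ind A) (ind A) x \<le> 2"
proof -
  let ?Y = "{y \<in> A. (x - y) mod N \<in> A}"
  have AI: "A \<subseteq> I" using A by (simp add: sidon_mod_def)
  have fin: "finite A" using AI finite_subset by blast
  have "conv (ind A) (ind A) x = (\<Sum>y\<in>A. if (x - y) mod N \<in> A then 1 else 0)"
    by (simp add: conv_ind[OF AI] ind_def)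
  also have "\<dots> = real (card ?Y)"
    using fin by (simp add: sum.If_cases Int_def)
  also have "card ?Y \<le> 2"
  proof (cases "?Y = {}")
    case True then show ?thesis by (simp only: True) simp
  next
    case False
    then obtain z where z: "z \<in> A" "(x - z) mod N \<in> A" by blast
    have "?Y \<subseteq> {z, (x - z) mod N}"
    proof
      fix y assume y: "y \<in> ?Y"
      have "(y + (x - y) mod N) mod N = (z + (x - z) mod N) mod N"
        by (simp add: mod_add_right_eq)
      then have "{y, (x - y) mod N} = {z, (x - z) mod N}"
        using sidon_modD[OF A] y z by blast
      then show "y \<in> {z, (x - z) mod N}" by blast
    qed
    then have "card ?Y \<le> card {z, (x - z) mod N}" by (intro card_mono) auto
    also have "\<dots> \<le> 2" by (simp add: card_insert_if)
    finally show ?thesis .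
  qed
  finally show ?thesis by simp
qed

lemma conv_nonneg: "(\<And>x. 0 \<le> f x) \<Longrightarrow> (\<And>x. 0 \<le> g x) \<Longrightarrow> 0 \<le> conv f g x"
  by (simp add: conv_def sum_nonneg)

lemma sum_conv:
  assumes g: "periodic g"
  shows "(\<Sum>x\<in>I. conv f g x) = (\<Sum>x\<in>I. f x) * (\<Sum>x\<in>I. g x)"
proof -
  have "(\<Sum>x\<in>I. conv f g x) = (\<Sum>y\<in>I. f y * (\<Sum>x\<in>I. g (x + - y)))"
    unfolding conv_def by (subst sum.swap) (simp add: sum_distrib_left)
  also have "\<dots> = (\<Sum>x\<in>I. f x) * (\<Sum>x\<in>I. g x)"
    using sum_shift[OF g] by (simp add: sum_distrib_right del: add_uminus_conv_diff)
  finally show ?thesis .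
qed

lemma sum_conv_square_le:
  assumes A: "sidon_mod A"
  shows "(\<Sum>x\<in>I. (conv (ind A) (ind A) x)\<^sup>2) \<le> 2 * (real (card A))\<^sup>2"
proof -
  have AI: "A \<subseteq> I" using A by (simp add: sidon_mod_def)
  have "(\<Sum>x\<in>I. (conv (ind A) (ind A) x)\<^sup>2) \<le> (\<Sum>x\<in>I. 2 * conv (ind A) (ind A) x)"
    unfolding power2_eq_square
    by (intro sum_mono mult_right_mono conv_ind_le_2[OF A] conv_nonneg) auto
  also have "\<dots> = 2 * (real (card A))\<^sup>2"
    by (simp add: sum_distrib_left[symmetric] sum_conv sum_ind[OF AI] power2_eq_square)
  finally show ?thesis .
qed

text \<open>Cauchy-Schwarz for the representation function: its total is the square of
  \<open>card A\<close>, while its supremum 2 controls its sum of squares.\<close>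

lemma sidon_card_le:
  assumes A: "sidon_mod A"
  shows "(real (card A))\<^sup>2 \<le> 2 * of_int N"
proof (cases "card A = 0")
  case True then show ?thesis using N_pos by simp
next
  case False
  have AI: "A \<subseteq> I" using A by (simp add: sidon_mod_def)
  let ?c = "conv (ind A) (ind A)" and ?a = "real (card A)"
  have "(?a\<^sup>2)\<^sup>2 = (\<Sum>x\<in>I. 1 * ?c x)\<^sup>2"
    by (simp add: sum_conv sum_ind[OF AI] power2_eq_square)
  also have "\<dots> \<le> (\<Sum>x\<in>I. 1\<^sup>2) * (\<Sum>x\<in>I. (?c x)\<^sup>2)"
    by (rule Cauchy_Schwarz_ineq_sum)
  also have "\<dots> \<le> of_int N * (2 * ?a\<^sup>2)"
    using N_pos sum_conv_square_le[OF A] by (simp add: mult_left_mono)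
  finally have "?a\<^sup>2 * ?a\<^sup>2 \<le> (2 * of_int N) * ?a\<^sup>2" by (simp add: power2_eq_square mult_ac)
  then show ?thesis using False by (subst (asm) mult_le_cancel_right) auto
qed

text \<open>By Parseval the fourth moment is \<open>N\<close> times the additive energy, which a
  Sidon set keeps below twice the square of \<open>card A\<close>. Frequency 0 alone contributes
  \<open>card A ^ 4\<close>, which has the same order when \<open>card A\<close> is comparable to
  \<open>sqrt N\<close>.\<close>

lemma fourth_moment_le:
  assumes A: "sidon_mod A"
  shows "(\<Sum>k\<in>I. norm (ft (ind A) k) ^ 4) \<le> 4 * (of_int N)\<^sup>2"
proof -
  have "(\<Sum>k\<in>I. norm (ft (ind A) k) ^ 4) = (\<Sum>k\<in>I. (norm (ft (conv (ind A) (ind A)) k))\<^sup>2)"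
    by (simp add: ft_conv norm_mult power4_eq_xxxx power2_eq_square mult.assoc)
  also have "\<dots> = of_int N * (\<Sum>x\<in>I. (conv (ind A) (ind A) x)\<^sup>2)"
    by (intro parseval periodic_conv periodic_ind)
  also have "\<dots> \<le> of_int N * (2 * (real (card A))\<^sup>2)"
    using sum_conv_square_le[OF A] N_pos by (simp add: mult_left_mono)
  also have "\<dots> \<le> of_int N * (2 * (2 * of_int N))"
    using sidon_card_le[OF A] N_pos by (intro mult_left_mono) auto
  finally show ?thesis by (simp add: power2_eq_square)
qed

text \<open>If \<open>x\<close>, \<open>y\<close>, \<open>x + d\<close> and \<open>y + d\<close> all
  lie in \<open>A\<close>, then \<open>x + (y + d) = y + (x + d)\<close> is a Sidon relation, and
  for nonzero \<open>d\<close> it forces \<open>x = y\<close>.\<close>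

lemma autocorrelation_le:
  assumes A: "sidon_mod A" and d: "\<not> N dvd d"
  shows "(\<Sum>x\<in>I. ind A x * ind A (x + d)) \<le> 1"
proof -
  let ?Y = "{y \<in> A. (y + d) mod N \<in> A}"
  have AI: "A \<subseteq> I" using A by (simp add: sidon_mod_def)
  have fin: "finite A" using AI finite_subset by blast
  have "(\<Sum>x\<in>I. ind A x * ind A (x + d)) = (\<Sum>y\<in>A. if (y + d) mod N \<in> A then 1 else 0)"
    using sum_ind_mult[OF AI, of "\<lambda>y. ind A (y + d)"] by (simp add: ind_def)
  also have "\<dots> = real (card ?Y)"
    using fin by (simp add: sum.If_cases Int_def)
  also have "card ?Y \<le> 1"
  proof (rule card_le_Suc0_iff_eq[THEN iffD2, unfolded One_nat_def[symmetric]])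
    show "\<forall>x\<in>?Y. \<forall>y\<in>?Y. x = y"
    proof (intro ballI)
      fix x y assume xy: "x \<in> ?Y" "y \<in> ?Y"
      have "(x + (y + d) mod N) mod N = (y + (x + d) mod N) mod N"
        by (simp add: mod_add_right_eq algebra_simps)
      then have "{x, (y + d) mod N} = {y, (x + d) mod N}"
        using sidon_modD[OF A] xy by blast
      moreover have "x \<noteq> (x + d) mod N"
      proof
        assume "x = (x + d) mod N"
        then have "x mod N = (x + d) mod N" by (metis mod_mod_trivial)
        then show False using d by (simp add: mod_eq_dvd_iff)
      qed
      ultimately show "x = y" by blast
    qed
  qed (use fin in auto)
  finally show ?thesis by simp
qed

section \<open>Averages of a Sidon set over translates\<close>

definition smooth :: "int set \<Rightarrow> int set \<Rightarrow> int \<Rightarrow> real" where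
  "smooth B A = conv (\<lambda>x. ind B x / card B) (ind A)"

lemma periodic_smooth: "periodic (smooth B A)"
  unfolding smooth_def by (intro periodic_conv periodic_ind)

lemma smooth_nonneg: "0 \<le> smooth B A x"
  unfolding smooth_def by (intro conv_nonneg) auto

lemma sum_smooth:
  assumes "A \<subseteq> I" "B \<subseteq> I" "B \<noteq> {}"
  shows "(\<Sum>x\<in>I. smooth B A x) = card A"
proof -
  have "card B \<noteq> 0" using assms finite_subset[of B I] by auto
  then show ?thesis
    using assms by (simp add: smooth_def sum_conv sum_ind sum_divide_distrib[symmetric])
qed

text \<open>Expanding the square gives correlations of translates of \<open>A\<close>: at most
  \<open>card A + 1\<close> for each of the \<open>card B\<close> diagonal pairs and at most 1 for
  the others. Once \<open>card B\<close> reaches \<open>card A\<close> the bound is 2, independently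
  of \<open>N\<close>.\<close>

lemma smooth_square_sum_le:
  assumes A: "sidon_mod A" and B: "B \<subseteq> I" "B \<noteq> {}"
  shows "(\<Sum>x\<in>I. (smooth B A x)\<^sup>2) \<le> card A / card B + 1"
proof -
  have AI: "A \<subseteq> I" using A by (simp add: sidon_mod_def)
  have fin: "finite B" using B finite_subset by blast
  let ?b = "real (card B)"
  have b: "?b > 0" using fin B by (simp add: card_gt_0_iff)
  have sm: "smooth B A x = (\<Sum>b\<in>B. ind A (x - b)) / ?b" for x
    using sum_ind_mult[OF B(1), of "\<lambda>y. ind A (x - y) / ?b"]
    by (simp add: smooth_def conv_def sum_divide_distrib)
  have corr: "(\<Sum>x\<in>I. ind A (x - b) * ind A (x - c)) \<le> (if b = c then real (card A) else 0) + 1"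
    if bc: "b \<in> B" "c \<in> B" for b c
  proof -
    have per: "periodic (\<lambda>x. ind A (x - b) * ind A (x - c))"
      unfolding periodic_def ind_def by (simp add: mod_diff_left_eq)
    have "(\<Sum>x\<in>I. ind A (x - b) * ind A (x - c)) = (\<Sum>x\<in>I. ind A x * ind A (x + (b - c)))"
      using sum_shift[OF per, of b] by (simp add: algebra_simps)
    also have "\<dots> \<le> (if b = c then real (card A) else 0) + 1"
    proof (cases "b = c")
      case True
      have "(\<Sum>x\<in>I. ind A x * ind A x) = (\<Sum>x\<in>I. ind A x)"
        by (intro sum.cong) (auto simp: ind_def)
      then show ?thesis using True sum_ind[OF AI] by simp
    next
      case False
      then have "\<not> N dvd b - c"
        using bc B(1) by (metis atLeastLessThan_iff mod_eq_dvd_iff mod_pos_pos_trivial subsetD)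
      then show ?thesis using False autocorrelation_le[OF A] by simp
    qed
    finally show ?thesis .
  qed
  have "(\<Sum>x\<in>I. (smooth B A x)\<^sup>2) = (\<Sum>x\<in>I. \<Sum>b\<in>B. \<Sum>c\<in>B. ind A (x - b) * ind A (x - c)) / ?b\<^sup>2"
    by (simp add: sm power_divide sum_divide_distrib[symmetric] power2_eq_square[of "sum _ _"] sum_product)
  also have "(\<Sum>x\<in>I. \<Sum>b\<in>B. \<Sum>c\<in>B. ind A (x - b) * ind A (x - c)) =
     (\<Sum>b\<in>B. \<Sum>c\<in>B. \<Sum>x\<in>I. ind A (x - b) * ind A (x - c))"
    by (subst sum.swap, rule sum.cong[OF refl], rule sum.swap)
  also have "\<dots> \<le> (\<Sum>b\<in>B. \<Sum>c\<in>B. (if b = c then real (card A) else 0) + 1)"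
    by (intro sum_mono corr)
  also have "\<dots> = ?b * real (card A) + ?b\<^sup>2"
    using fin by (simp add: sum.distrib power2_eq_square distrib_left)
  finally have "(\<Sum>x\<in>I. (smooth B A x)\<^sup>2) \<le> (?b * real (card A) + ?b\<^sup>2) / ?b\<^sup>2"
    using b by (simp add: divide_right_mono)
  also have "\<dots> = card A / card B + 1"
    using b by (simp add: field_simps power2_eq_square)
  finally show ?thesis .
qed

definition ft_bump :: "int set \<Rightarrow> int \<Rightarrow> complex" where
  "ft_bump B = ft (\<lambda>x. ind B x / card B)"

lemma ft_smooth: "ft (smooth B A) k = ft_bump B k * ft (ind A) k"
  by (simp add: smooth_def ft_bump_def ft_conv)

lemma ft_bump_eq: "B \<subseteq> I \<Longrightarrow> ft_bump B k = (\<Sum>b\<in>B. ec (k * b)) / card B"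
  using sum_ind_mult[of B "\<lambda>x. ec (k * x) / card B"]
  by (simp add: ft_bump_def ft_def sum_divide_distrib)

lemma norm_ft_bump_le_1: 
  assumes "B \<subseteq> I" shows "norm (ft_bump B k) \<le> 1"
proof -
  have "norm (\<Sum>b\<in>B. ec (k * b)) \<le> card B" using norm_sum[of "\<lambda>x. ec (k * x)" B] by simp
  then show ?thesis using assms by (auto simp: ft_bump_eq norm_divide divide_le_eq_1)
qed

lemma sum_norm_ft_bump_square:
  assumes B: "B \<subseteq> I" "B \<noteq> {}"
  shows "(\<Sum>k\<in>I. (norm (ft_bump B k))\<^sup>2) = of_int N / card B"
proof -
  have "card B \<noteq> 0" using assms finite_subset[of B I] by auto
  have per: "periodic (\<lambda>x. ind B x / real (card B))"
    using periodic_ind[of B] unfolding periodic_def by simp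
  have "(ind B x)\<^sup>2 = ind B x" for x by (simp add: ind_def)
  then have "(\<Sum>x\<in>I. (ind B x / card B)\<^sup>2) = card B / (real (card B))\<^sup>2"
    using sum_ind[OF B(1)] by (simp add: power_divide sum_divide_distrib[symmetric])
  then show ?thesis
    using parseval[OF per] \<open>card B \<noteq> 0\<close> by (simp add: ft_bump_def power2_eq_square)
qed

lemma norm_ft_bump_minus_1_le:
  assumes B: "B \<subseteq> I" "B \<noteq> {}" and r: "\<And>b. b \<in> B \<Longrightarrow> norm (ec (k * b) - 1) \<le> r"
  shows "norm (ft_bump B k - 1) \<le> r"
proof -
  have b: "card B > 0" using assms finite_subset[of B I] by (simp add: card_gt_0_iff)
  have "ft_bump B k - 1 = (\<Sum>b\<in>B. ec (k * b) - 1) / card B"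
    using b by (simp add: ft_bump_eq[OF B(1)] sum_subtractf diff_divide_distrib)
  also have "norm \<dots> \<le> (\<Sum>b\<in>B. norm (ec (k * b) - 1)) / card B"
    by (simp add: norm_divide divide_right_mono norm_sum)
  also have "\<dots> \<le> (\<Sum>b\<in>B. r) / card B" by (intro divide_right_mono sum_mono r) auto
  also have "\<dots> = r" using b by simp
  finally show ?thesis .
qed

end

section \<open>Counting solutions after smoothing\<close>

lemma norm_one_minus_power4_mult_le:
  fixes x y :: complex
  assumes "norm x \<le> 1" "norm y \<le> 1"
  shows "norm (1 - x ^ 4 * y) \<le> 4 * norm (x - 1) + norm (y - 1)"
proof -
  have pow: "norm x ^ n \<le> 1" for n using assms by (simp add: power_le_one)
  have "1 - x ^ 4 * y = (1 - y) + y * ((1 - x) * (1 + x + x\<^sup>2 + x ^ 3))"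
    by (simp add: algebra_simps power2_eq_square power3_eq_cube power4_eq_xxxx)
  also have "norm \<dots> \<le> norm (1 - y) + norm y * (norm (1 - x) * norm (1 + x + x\<^sup>2 + x ^ 3))"
    by (metis norm_mult norm_triangle_ineq)
  also have "\<dots> \<le> norm (1 - y) + 1 * (norm (1 - x) * 4)"
  proof -
    have "norm (1 + x + x\<^sup>2 + x ^ 3) \<le> norm (1::complex) + norm x + norm (x\<^sup>2) + norm (x ^ 3)"
      by (intro order_trans[OF norm_triangle_ineq] add_mono order_refl)
    also have "\<dots> \<le> 4" using pow[of 1] pow[of 2] pow[of 3] by (simp add: norm_power)
    finally show ?thesis using assms by (intro add_left_mono mult_mono) auto
  qed
  finally show ?thesis by (simp add: norm_minus_commute)
qed

lemma power5_le_prod: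
  fixes h :: real
  assumes "0 \<le> h" "h \<le> a" "h \<le> b" "h \<le> c" "h \<le> d" "h \<le> e"
  shows "h ^ 5 \<le> a * (b * c * d * e)"
proof -
  have "h * h \<le> b * c" using assms by (intro mult_mono) auto
  then have "h * h * h \<le> b * c * d" using assms by (intro mult_mono) auto
  then have "h * h * h * h \<le> b * c * d * e" using assms by (intro mult_mono) auto
  then have "h * (h * h * h * h) \<le> a * (b * c * d * e)" using assms by (intro mult_mono) auto
  then show ?thesis by (simp add: power_numeral_reduce mult.assoc)
qed

context cyclic
begin

text \<open>The threshold is measured in units of \<open>sqrt N\<close>, the largest possible order
  of \<open>card A\<close> and hence of a coefficient. The fourth moment then bounds the size of the
  spectrum independently of \<open>N\<close>.\<close>

definition spec :: "int set \<Rightarrow> real \<Rightarrow> int set" where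
  "spec A e = {k \<in> I. e * sqrt (of_int N) \<le> norm (ft (ind A) k)}"

lemma spec_subset: "spec A e \<subseteq> I"
  by (auto simp: spec_def)

lemma finite_spec [simp]: "finite (spec A e)"
  using spec_subset finite_subset by blast

lemma spec_mono:
  assumes "e \<le> e'" shows "spec A e' \<subseteq> spec A e"
proof -
  have "e * sqrt (of_int N) \<le> e' * sqrt (of_int N)"
    using assms N_pos by (intro mult_right_mono) auto
  then show ?thesis unfolding spec_def by (auto intro: order_trans)
qed

lemma card_spec_le:
  assumes A: "sidon_mod A" and e: "0 < e"
  shows "real (card (spec A e)) \<le> 4 / e ^ 4"
proof -
  have N: "real_of_int N > 0" using N_pos by simp
  have "real (card (spec A e)) * (e * sqrt (of_int N)) ^ 4 = (\<Sum>k\<in>spec A e. (e * sqrt (of_int N)) ^ 4)"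
    by simp
  also have "\<dots> \<le> (\<Sum>k\<in>spec A e. norm (ft (ind A) k) ^ 4)"
    using e N_pos by (intro sum_mono power_mono) (auto simp: spec_def)
  also have "\<dots> \<le> (\<Sum>k\<in>I. norm (ft (ind A) k) ^ 4)"
    by (intro sum_mono2 spec_subset) auto
  also have "\<dots> \<le> 4 * (of_int N)\<^sup>2" by (rule fourth_moment_le[OF A])
  finally have "real (card (spec A e)) * e ^ 4 * (of_int N)\<^sup>2 \<le> 4 * (of_int N)\<^sup>2"
    using N by (simp add: power_mult_distrib power4_eq_xxxx power2_eq_square mult_ac)
  then have "real (card (spec A e)) * e ^ 4 \<le> 4" using N by (subst (asm) mult_le_cancel_right) auto
  then show ?thesis using e by (simp add: field_simps)
qed

text \<open>Phrased through the size of the coefficient instead of membership of \<open>k\<close> in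
  the spectrum, so that it also applies at \<open>- 4 * k\<close>, which need not lie in
  \<open>I\<close>.\<close>

lemma ft_bump_spec:
  assumes B: "B \<subseteq> bohr (spec A e) e" "B \<noteq> {}" and k: "e * sqrt (of_int N) \<le> norm (ft (ind A) k)"
  shows "norm (ft_bump B k - 1) \<le> e"
proof (rule norm_ft_bump_minus_1_le)
  show "B \<subseteq> I" using B bohr_subset by blast
  fix b assume "b \<in> B"
  moreover have "k mod N \<in> spec A e" using k N_pos by (simp add: spec_def ft_mod)
  ultimately have "norm (ec ((k mod N) * b) - 1) \<le> e" using B by (auto simp: bohr_def)
  moreover have "ec ((k mod N) * b) = ec (k * b)" by (rule ec_cong) (simp add: mod_mult_left_eq)
  ultimately show "norm (ec (k * b) - 1) \<le> e" by simp
qed (use B in auto)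

text \<open>On the Fourier side the difference is a sum of terms
  \<open>F k ^ 4 * F (- 4 * k)\<close> times \<open>1 - b k ^ 4 * b (- 4 * k)\<close>, with
  \<open>F\<close> and \<open>b\<close> the transforms of \<open>A\<close> and of the averaging
  weight. If both coefficients of \<open>A\<close> are large, the last factor is at most
  \<open>5 * e\<close>; otherwise one of them is below \<open>e * sqrt N\<close>. Either way
  \<open>e * sqrt N\<close> splits off and fourth powers remain, whose sum is the fourth
  moment.\<close>

lemma count5_smooth_close:
  assumes A: "sidon_mod A" and N: "odd N" and e: "0 < e"
    and B: "B \<subseteq> bohr (spec A e) e" "B \<noteq> {}"
  shows "\<bar>count5 (ind A) - count5 (smooth B A)\<bar> \<le> 64 * e * (of_int N * sqrt (of_int N))"
proof -
  let ?F = "ft (ind A)" and ?b = "ft_bump B" and ?s = "sqrt (real_of_int N)"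
  have AI: "A \<subseteq> I" using A by (simp add: sidon_mod_def)
  have BI: "B \<subseteq> I" using B bohr_subset by blast
  have s: "?s > 0" using N_pos by simp
  \<comment> \<open>\<open>3 / 2\<close> is a rational bound for the \<open>sqrt 2\<close> that
    comes from \<open>sidon_card_le\<close>.\<close>
  have cardA: "real (card A) \<le> 3 / 2 * ?s"
  proof -
    have "(real (card A))\<^sup>2 \<le> (3 / 2 * ?s)\<^sup>2"
      using sidon_card_le[OF A] N_pos by (simp add: power_mult_distrib power_divide)
    then show ?thesis by (rule power2_le_imp_le) (use s in simp)
  qed
  have term_le: "norm (?F k ^ 4 * ?F (- 4 * k) * (1 - ?b k ^ 4 * ?b (- 4 * k)))
      \<le> 8 * e * ?s * (norm (?F k) ^ 4 + norm (?F (- 4 * k)) ^ 4)" for k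
  proof -
    define u v where "u = norm (?F k)" and "v = norm (?F (- 4 * k))"
    define w where "w = norm (1 - ?b k ^ 4 * ?b (- 4 * k))"
    have uv: "0 \<le> u" "0 \<le> v" by (auto simp: u_def v_def)
    have vA: "v \<le> 3 / 2 * ?s" using norm_ft_ind_le[OF AI, of "- 4 * k"] cardA v_def by linarith
    have w0: "0 \<le> w" by (simp add: w_def)
    have w2: "w \<le> 2"
    proof -
      have "w \<le> 1 + norm (?b k) ^ 4 * norm (?b (- 4 * k))"
        unfolding w_def by (rule order_trans[OF norm_triangle_ineq4]) (simp add: norm_mult norm_power)
      moreover have "norm (?b k) ^ 4 * norm (?b (- 4 * k)) \<le> 1"
        by (intro mult_le_one power_le_one norm_ft_bump_le_1[OF BI] norm_ge_zero)
      ultimately show ?thesis by linarith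
    qed
    have es: "0 < e * ?s" using e s by simp
    have u4: "0 \<le> u ^ 4" and v4: "0 \<le> v ^ 4" using uv by auto
    \<comment> \<open>The common constant 8 covers \<open>3 / 2 * 5\<close> when both coefficients
      are large and 2 in the other cases.\<close>
    have base: "c * ((e * ?s) * u ^ 4) \<le> 8 * ((e * ?s) * (u ^ 4 + v ^ 4))" if "0 \<le> c" "c \<le> 8" for c
      by (rule mult_mono, rule that, rule mult_left_mono) (use that es u4 v4 in auto)
    have bnd1: "u ^ 4 * (3 / 2 * ?s * (5 * e)) \<le> 8 * e * ?s * (u ^ 4 + v ^ 4)"
      using base[of "15 / 2"] by (simp add: mult_ac)
    have bnd2: "u ^ 4 * (e * ?s * 2) \<le> 8 * e * ?s * (u ^ 4 + v ^ 4)"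
      using base[of 2] by (simp add: mult_ac)
    consider "e * ?s \<le> u" "e * ?s \<le> v" | "v < e * ?s" | "u < e * ?s" by linarith
    then have "u ^ 4 * v * w \<le> 8 * e * ?s * (u ^ 4 + v ^ 4)"
    proof cases
      case 1
      have "w \<le> 4 * norm (?b k - 1) + norm (?b (- 4 * k) - 1)"
        unfolding w_def by (intro norm_one_minus_power4_mult_le norm_ft_bump_le_1[OF BI])
      also have "\<dots> \<le> 5 * e"
        using ft_bump_spec[OF B, of k] ft_bump_spec[OF B, of "- 4 * k"] 1 by (simp add: u_def v_def)
      finally have "u ^ 4 * (v * w) \<le> u ^ 4 * ((3 / 2 * ?s) * (5 * e))"
        using vA uv w0 s e by (intro mult_left_mono mult_mono) auto
      also have "\<dots> \<le> 8 * e * ?s * (u ^ 4 + v ^ 4)" by (rule bnd1)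
      finally show ?thesis by (simp add: mult.assoc)
    next
      case 2
      have "u ^ 4 * (v * w) \<le> u ^ 4 * ((e * ?s) * 2)"
        using 2 uv w0 w2 s e by (intro mult_left_mono mult_mono) auto
      also have "\<dots> \<le> 8 * e * ?s * (u ^ 4 + v ^ 4)" by (rule bnd2)
      finally show ?thesis by (simp add: mult.assoc)
    next
      case 3
      \<comment> \<open>One of the four factors \<open>u\<close> supplies the gain; the remaining
        product mixes two frequencies and is bounded by the larger fourth power.\<close>
      have uv3: "u ^ 3 * v \<le> u ^ 4 + v ^ 4"
      proof (cases "u \<le> v")
        case True
        then have "u ^ 3 * v \<le> v ^ 3 * v" using uv by (intro mult_right_mono power_mono) auto
        then have "u ^ 3 * v \<le> v ^ 4" by (simp add: power3_eq_cube power4_eq_xxxx)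
        then show ?thesis using u4 by linarith
      next
        case False
        then have "u ^ 3 * v \<le> u ^ 3 * u" using uv by (intro mult_left_mono) auto
        then have "u ^ 3 * v \<le> u ^ 4" by (simp add: power3_eq_cube power4_eq_xxxx)
        then show ?thesis using v4 by linarith
      qed
      have "u ^ 4 * v * w = (u * w) * (u ^ 3 * v)" by (simp add: power4_eq_xxxx power3_eq_cube mult_ac)
      also have "\<dots> \<le> ((e * ?s) * 2) * (u ^ 4 + v ^ 4)"
        using 3 uv w0 w2 s e uv3 by (intro mult_mono) auto
      also have "\<dots> \<le> 8 * e * ?s * (u ^ 4 + v ^ 4)"
        using uv s e by (intro mult_right_mono) auto
      finally show ?thesis .
    qed
    then show ?thesis by (simp add: norm_mult norm_power u_def v_def w_def)
  qed
  have per: "periodic (\<lambda>k. norm (?F k) ^ 4)" by (simp add: periodic_def ft_mod)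
  have "coprime (2 ^ 2) N" using N unfolding coprime_power_left_iff by simp
  then have cop: "coprime (- 4) N" by simp
  have dil: "(\<Sum>k\<in>I. norm (?F (- 4 * k)) ^ 4) = (\<Sum>k\<in>I. norm (?F k) ^ 4)"
    using sum_affine[OF per cop, of 0] by simp
  have "of_int N * complex_of_real (count5 (ind A) - count5 (smooth B A)) =
     (\<Sum>k\<in>I. ?F k ^ 4 * ?F (- 4 * k)) - (\<Sum>k\<in>I. ft (smooth B A) k ^ 4 * ft (smooth B A) (- 4 * k))"
    unfolding count5_fourier[OF periodic_ind, symmetric] count5_fourier[OF periodic_smooth, symmetric]
    by (simp add: right_diff_distrib)
  also have "\<dots> = (\<Sum>k\<in>I. ?F k ^ 4 * ?F (- 4 * k) * (1 - ?b k ^ 4 * ?b (- 4 * k)))"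
  proof -
    have "x ^ 4 * y - (b * x) ^ 4 * (c * y) = x ^ 4 * y * (1 - b ^ 4 * c)" for x y b c :: complex
      by (simp add: power_mult_distrib algebra_simps)
    then show ?thesis unfolding ft_smooth sum_subtractf[symmetric] by (intro sum.cong refl)
  qed
  finally have eq: "of_int N * complex_of_real (count5 (ind A) - count5 (smooth B A)) =
    (\<Sum>k\<in>I. ?F k ^ 4 * ?F (- 4 * k) * (1 - ?b k ^ 4 * ?b (- 4 * k)))" .
  have "of_int N * \<bar>count5 (ind A) - count5 (smooth B A)\<bar> =
      norm (of_int N * complex_of_real (count5 (ind A) - count5 (smooth B A)))"
    using N_pos by (simp only: norm_mult norm_of_int norm_of_real)
  also have "\<dots> = norm (\<Sum>k\<in>I. ?F k ^ 4 * ?F (- 4 * k) * (1 - ?b k ^ 4 * ?b (- 4 * k)))"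
    by (simp only: eq)
  also have "\<dots> \<le> (\<Sum>k\<in>I. 8 * e * ?s * (norm (?F k) ^ 4 + norm (?F (- 4 * k)) ^ 4))"
    by (rule sum_norm_le) (rule term_le)
  also have "\<dots> = 8 * e * ?s * (2 * (\<Sum>k\<in>I. norm (?F k) ^ 4))"
    by (simp only: sum_distrib_left[symmetric] sum.distrib dil) simp
  also have "\<dots> \<le> 8 * e * ?s * (2 * (4 * (of_int N)\<^sup>2))"
    using fourth_moment_le[OF A] e s by (intro mult_left_mono) auto
  also have "\<dots> = of_int N * (64 * e * (of_int N * ?s))" by (simp add: power2_eq_square)
  finally show ?thesis using N_pos by (subst (asm) mult_le_cancel_left) auto
qed

section \<open>Almost invariance under translation and popular points\<close>

lemma shift_square_sum:
  assumes f: "periodic f"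
  shows "of_int N * (\<Sum>x\<in>I. (f (x + t) - f x)\<^sup>2) = (\<Sum>k\<in>I. (norm (ft f k) * norm (ec (k * t) - 1))\<^sup>2)"
proof -
  let ?g = "\<lambda>x. f (x + t) - f x"
  have g: "periodic ?g" using periodic_shift[OF f, of t] f by (simp add: periodic_def)
  have "ft ?g k = (ec (- (k * t)) - 1) * ft f k" for k
  proof -
    have "ft ?g k = ft (\<lambda>x. f (x + t)) k - ft f k"
      by (simp add: ft_def sum_subtractf left_diff_distrib)
    then show ?thesis by (simp add: ft_shift[OF f] left_diff_distrib)
  qed
  moreover have "norm (ec (- x) - 1) = norm (ec x - 1)" for x
    by (metis complex_cnj_diff complex_cnj_one complex_mod_cnj ec_minus)
  ultimately have "norm (ft ?g k) = norm (ft f k) * norm (ec (k * t) - 1)" for k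
    by (simp add: norm_mult)
  then show ?thesis using parseval[OF g] by simp
qed

lemma shift_square_sum_le:
  assumes f: "periodic f" and K: "K \<subseteq> I" and r: "\<And>k. k \<in> K \<Longrightarrow> norm (ec (k * t) - 1) \<le> r"
  shows "of_int N * (\<Sum>x\<in>I. (f (x + t) - f x)\<^sup>2) \<le>
    r\<^sup>2 * (of_int N * (\<Sum>x\<in>I. (f x)\<^sup>2)) + 4 * (\<Sum>k\<in>I-K. (norm (ft f k))\<^sup>2)"
proof -
  have n2: "norm (ec x - 1) \<le> 2" for x
    using norm_triangle_ineq4[of "ec x" 1] by simp
  have "(\<Sum>k\<in>I. (norm (ft f k) * norm (ec (k * t) - 1))\<^sup>2) =
      (\<Sum>k\<in>K. (norm (ec (k * t) - 1))\<^sup>2 * (norm (ft f k))\<^sup>2) +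
      (\<Sum>k\<in>I-K. (norm (ec (k * t) - 1))\<^sup>2 * (norm (ft f k))\<^sup>2)"
    using sum.subset_diff[OF K, of "\<lambda>k. (norm (ec (k * t) - 1))\<^sup>2 * (norm (ft f k))\<^sup>2"]
    by (simp add: power_mult_distrib mult_ac)
  also have "\<dots> \<le> (\<Sum>k\<in>K. r\<^sup>2 * (norm (ft f k))\<^sup>2) + (\<Sum>k\<in>I-K. 2\<^sup>2 * (norm (ft f k))\<^sup>2)"
    by (intro add_mono sum_mono mult_right_mono power_mono r n2) auto
  also have "(\<Sum>k\<in>K. r\<^sup>2 * (norm (ft f k))\<^sup>2) \<le> (\<Sum>k\<in>I. r\<^sup>2 * (norm (ft f k))\<^sup>2)"
    using K by (intro sum_mono2) auto
  finally show ?thesis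
    unfolding shift_square_sum[OF f] by (simp add: sum_distrib_left[symmetric] parseval[OF f])
qed

text \<open>Points where \<open>f\<close> is at least half its mean carry half of the mass, so
  Cauchy-Schwarz and the energy bound give at least \<open>\<alpha>\<^sup>2 / 8\<close> of them. By
  Chebyshev's inequality each \<open>t\<close> changes \<open>f\<close> by a quarter of the mean on
  at most \<open>\<alpha>\<^sup>2 / 64\<close> points, and at most four such exceptional sets are
  removed.\<close>

lemma popular_correlation:
  assumes nonneg: "\<And>x. 0 \<le> f x"
    and mass: "(\<Sum>x\<in>I. f x) = \<alpha>" "0 < \<alpha>" and energy: "(\<Sum>x\<in>I. (f x)\<^sup>2) \<le> 2"
    and T: "finite T" "card T \<le> 4" "\<And>t. t \<in> T \<Longrightarrow> (\<Sum>x\<in>I. (f (x + t) - f x)\<^sup>2) \<le> \<theta>"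
    and \<theta>: "1024 * \<theta> * (of_int N)\<^sup>2 \<le> \<alpha> ^ 4"
  shows "\<exists>Z\<subseteq>I. \<alpha>\<^sup>2 / 16 \<le> real (card Z) \<and>
    (\<forall>z\<in>Z. \<alpha> / (4 * of_int N) \<le> f z \<and> (\<forall>t\<in>T. \<alpha> / (4 * of_int N) \<le> f (z + t)))"
proof -
  have N: "real_of_int N > 0" using N_pos by simp
  let ?h = "\<alpha> / (4 * of_int N)"
  have h: "?h > 0" using N mass by simp
  define P where "P = {z \<in> I. 2 * ?h \<le> f z}"
  define bad where "bad t = {z \<in> I. ?h \<le> \<bar>f (z + t) - f z\<bar>}" for t
  have PI: "P \<subseteq> I" and finP: "finite P" by (auto simp: P_def intro: finite_subset[of _ I])
  have badI: "bad t \<subseteq> I" and finbad: "finite (bad t)" for t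
    by (auto simp: bad_def intro: finite_subset[of _ I])
  have "(\<Sum>x\<in>I-P. f x) \<le> (\<Sum>x\<in>I-P. 2 * ?h)"
    by (intro sum_mono) (auto simp: P_def)
  also have "\<dots> \<le> (\<Sum>x\<in>I. 2 * ?h)" using h by (intro sum_mono2) auto
  also have "\<dots> = \<alpha> / 2" using N by simp
  finally have "\<alpha> / 2 \<le> (\<Sum>x\<in>P. 1 * f x)"
    using sum.subset_diff[OF PI, of f] mass by simp
  then have "(\<alpha> / 2)\<^sup>2 \<le> (\<Sum>x\<in>P. 1 * f x)\<^sup>2" using mass by (intro power_mono) auto
  also have "\<dots> \<le> (\<Sum>x\<in>P. 1\<^sup>2) * (\<Sum>x\<in>P. (f x)\<^sup>2)" by (rule Cauchy_Schwarz_ineq_sum)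
  also have "\<dots> \<le> real (card P) * 2"
  proof -
    have "(\<Sum>x\<in>P. (f x)\<^sup>2) \<le> (\<Sum>x\<in>I. (f x)\<^sup>2)" using PI by (intro sum_mono2) auto
    then show ?thesis using energy by (simp add: mult_left_mono)
  qed
  finally have cardP: "\<alpha>\<^sup>2 / 8 \<le> real (card P)" by (simp add: power_divide)
  have cardbad: "real (card (bad t)) \<le> \<alpha>\<^sup>2 / 64" if t: "t \<in> T" for t
  proof -
    have "real (card (bad t)) * ?h\<^sup>2 = (\<Sum>x\<in>bad t. ?h\<^sup>2)" by simp
    also have "\<dots> \<le> (\<Sum>x\<in>bad t. (f (x + t) - f x)\<^sup>2)"
    proof (rule sum_mono)
      fix x assume "x \<in> bad t"
      then have "?h \<le> \<bar>f (x + t) - f x\<bar>" by (simp add: bad_def)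
      then have "?h\<^sup>2 \<le> \<bar>f (x + t) - f x\<bar>\<^sup>2" using h by (intro power_mono) auto
      then show "?h\<^sup>2 \<le> (f (x + t) - f x)\<^sup>2" by simp
    qed
    also have "\<dots> \<le> (\<Sum>x\<in>I. (f (x + t) - f x)\<^sup>2)" using badI by (intro sum_mono2) auto
    also have "\<dots> \<le> \<theta>" by (rule T(3)[OF t])
    \<comment> \<open>\<open>1024 = 16 * 64\<close>: 16 from the square of the quarter mean, 64 for
      the proportion of points that each \<open>t\<close> may spoil.\<close>
    finally have "real (card (bad t)) * ?h\<^sup>2 * (1024 * (of_int N)\<^sup>2) \<le> \<theta> * (1024 * (of_int N)\<^sup>2)"
      by (intro mult_right_mono) auto
    also have "\<dots> \<le> \<alpha> ^ 4" using \<theta> by (simp add: mult_ac)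
    finally have "real (card (bad t)) * 64 * \<alpha>\<^sup>2 \<le> \<alpha>\<^sup>2 * \<alpha>\<^sup>2"
      using N by (simp add: power_divide power_mult_distrib power2_eq_square power4_eq_xxxx mult_ac)
    then have "real (card (bad t)) * 64 \<le> \<alpha>\<^sup>2"
      using mass by (subst (asm) mult_le_cancel_right) auto
    then show ?thesis by simp
  qed
  define Z where "Z = P - (\<Union>t\<in>T. bad t)"
  have finU: "finite (\<Union>t\<in>T. bad t)" using T finbad by blast
  have "real (card (\<Union>t\<in>T. bad t)) \<le> real (\<Sum>t\<in>T. card (bad t))"
    using card_UN_le[OF T(1)] by (simp only: of_nat_le_iff)
  also have "\<dots> \<le> (\<Sum>t\<in>T. \<alpha>\<^sup>2 / 64)" using cardbad by (simp add: sum_mono del: sum_constant)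
  also have "\<dots> \<le> \<alpha>\<^sup>2 / 16"
  proof -
    have "real (card T) * (\<alpha>\<^sup>2 / 64) \<le> 4 * (\<alpha>\<^sup>2 / 64)" using T by (intro mult_right_mono) auto
    then show ?thesis by simp
  qed
  finally have "\<alpha>\<^sup>2 / 16 \<le> real (card P) - real (card (\<Union>t\<in>T. bad t))" using cardP by simp
  also have "\<dots> \<le> real (card Z)"
    using diff_card_le_card_Diff[OF finU, of P] unfolding Z_def by linarith
  finally have cardZ: "\<alpha>\<^sup>2 / 16 \<le> real (card Z)" .
  have "?h \<le> f z \<and> (\<forall>t\<in>T. ?h \<le> f (z + t))" if "z \<in> Z" for z
  proof (intro conjI ballI)
    have z: "z \<in> I" "2 * ?h \<le> f z" using that by (auto simp: Z_def P_def)
    then show "?h \<le> f z" using h by linarith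
    fix t assume "t \<in> T"
    then have "\<not> ?h \<le> \<bar>f (z + t) - f z\<bar>" using that z by (auto simp: Z_def bad_def)
    then show "?h \<le> f (z + t)" using z by linarith
  qed
  moreover have "Z \<subseteq> I" using PI by (auto simp: Z_def)
  ultimately show ?thesis using cardZ by blast
qed

text \<open>In the form given by \<open>conv4_diagonal\<close>, each triple of offsets from
  \<open>B\<close> has at least \<open>\<alpha>\<^sup>2 / 16\<close> base points at which all five
  factors are at least a quarter of the mean.\<close>

lemma count5_lower:
  assumes f: "periodic f" and nonneg: "\<And>x. 0 \<le> f x"
    and mass: "(\<Sum>x\<in>I. f x) = \<alpha>" "0 < \<alpha>" and energy: "(\<Sum>x\<in>I. (f x)\<^sup>2) \<le> 2"
    and B: "B \<subseteq> I"
    and ap: "\<And>r s t u. r \<in> B \<Longrightarrow> s \<in> B \<Longrightarrow> t \<in> B \<Longrightarrow> u \<in> {r, s, t, - r - s - t} \<Longrightarrow>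
        (\<Sum>x\<in>I. (f (x + u) - f x)\<^sup>2) \<le> \<theta>"
    and \<theta>: "1024 * \<theta> * (of_int N)\<^sup>2 \<le> \<alpha> ^ 4"
  shows "real (card B) ^ 3 * (\<alpha>\<^sup>2 / 16 * (\<alpha> / (4 * of_int N)) ^ 5) \<le> count5 f"
proof -
  let ?h = "\<alpha> / (4 * of_int N)"
  let ?p = "\<lambda>z r s t. f z * (f (z + r) * f (z + s) * f (z + t) * f (z - r - s - t))"
  have h: "?h > 0" using N_pos mass by simp
  have pn: "0 \<le> ?p z r s t" for z r s t using nonneg by simp
  have one: "\<alpha>\<^sup>2 / 16 * ?h ^ 5 \<le> (\<Sum>z\<in>I. ?p z r s t)" if "r \<in> B" "s \<in> B" "t \<in> B" for r s t
  proof -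
    let ?T = "{r, s, t, - r - s - t}"
    have fin: "finite ?T" "card ?T \<le> 4" by (auto simp: card_insert_if)
    have apT: "(\<Sum>x\<in>I. (f (x + u) - f x)\<^sup>2) \<le> \<theta>" if "u \<in> ?T" for u
      by (rule ap[OF \<open>r \<in> B\<close> \<open>s \<in> B\<close> \<open>t \<in> B\<close> that])
    obtain Z where Z: "Z \<subseteq> I" "\<alpha>\<^sup>2 / 16 \<le> real (card Z)"
      "\<And>z. z \<in> Z \<Longrightarrow> ?h \<le> f z" "\<And>z u. z \<in> Z \<Longrightarrow> u \<in> ?T \<Longrightarrow> ?h \<le> f (z + u)"
      using popular_correlation[OF nonneg mass energy fin apT \<theta>] by blast
    have "\<alpha>\<^sup>2 / 16 * ?h ^ 5 \<le> real (card Z) * ?h ^ 5" using Z h by (intro mult_right_mono) auto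
    also have "\<dots> = (\<Sum>z\<in>Z. ?h ^ 5)" by simp
    also have "\<dots> \<le> (\<Sum>z\<in>Z. ?p z r s t)"
    proof (rule sum_mono)
      fix z assume z: "z \<in> Z"
      have "?h \<le> f (z - r - s - t)" using Z(4)[OF z, of "- r - s - t"] by (simp add: algebra_simps)
      then show "?h ^ 5 \<le> ?p z r s t"
        using Z(4)[OF z, of r] Z(4)[OF z, of s] Z(4)[OF z, of t] h
        by (intro power5_le_prod Z(3)[OF z]) auto
    qed
    also have "\<dots> \<le> (\<Sum>z\<in>I. ?p z r s t)" using Z(1) pn by (intro sum_mono2) auto
    finally show ?thesis .
  qed
  have mono: "(\<Sum>x\<in>B. g x) \<le> (\<Sum>x\<in>I. g' x)"
    if "\<And>x. x \<in> B \<Longrightarrow> g x \<le> g' x" "\<And>x. 0 \<le> g' x" for g g' :: "int \<Rightarrow> real"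
  proof -
    have "(\<Sum>x\<in>B. g x) \<le> (\<Sum>x\<in>B. g' x)" using that by (intro sum_mono) auto
    also have "\<dots> \<le> (\<Sum>x\<in>I. g' x)" using that B by (intro sum_mono2) auto
    finally show ?thesis .
  qed
  have "real (card B) ^ 3 * (\<alpha>\<^sup>2 / 16 * ?h ^ 5) = (\<Sum>r\<in>B. \<Sum>s\<in>B. \<Sum>t\<in>B. \<alpha>\<^sup>2 / 16 * ?h ^ 5)"
    by (simp add: power3_eq_cube mult.assoc)
  also have "\<dots> \<le> (\<Sum>r\<in>I. \<Sum>s\<in>I. \<Sum>t\<in>I. \<Sum>z\<in>I. ?p z r s t)"
    by (intro mono one sum_nonneg pn)
  also have "\<dots> = (\<Sum>z\<in>I. \<Sum>r\<in>I. \<Sum>s\<in>I. \<Sum>t\<in>I. ?p z r s t)"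
  proof -
    have "(\<Sum>r\<in>I. \<Sum>s\<in>I. \<Sum>t\<in>I. \<Sum>z\<in>I. ?p z r s t) = (\<Sum>r\<in>I. \<Sum>s\<in>I. \<Sum>z\<in>I. \<Sum>t\<in>I. ?p z r s t)"
      by (rule sum.cong[OF refl], rule sum.cong[OF refl], rule sum.swap)
    also have "\<dots> = (\<Sum>r\<in>I. \<Sum>z\<in>I. \<Sum>s\<in>I. \<Sum>t\<in>I. ?p z r s t)"
      by (rule sum.cong[OF refl], rule sum.swap)
    also have "\<dots> = (\<Sum>z\<in>I. \<Sum>r\<in>I. \<Sum>s\<in>I. \<Sum>t\<in>I. ?p z r s t)" by (rule sum.swap)
    finally show ?thesis .
  qed
  also have "\<dots> = count5 f"
    unfolding count5_def conv4_diagonal[OF f] by (simp only: sum_distrib_left)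
  finally show ?thesis .
qed

end

section \<open>Solutions in dense Sidon sets\<close>

context cyclic
begin

text \<open>On the spectrum, averaging over the Bohr set keeps at least half of each coefficient, so
  the energy there is at most four times that of the smoothed set. The bound is free of
  \<open>e\<close>; this is what limits the growth of energy along a sequence of levels.\<close>

lemma energy_spec_le:
  assumes A: "sidon_mod A" and e: "0 < e" "e \<le> 1 / 2"
    and B: "bohr (spec A e) e \<noteq> {}" "card A \<le> card (bohr (spec A e) e)"
  shows "(\<Sum>k\<in>spec A e. (norm (ft (ind A) k))\<^sup>2) \<le> 8 * of_int N"
proof -
  let ?B = "bohr (spec A e) e" and ?F = "ft (ind A)"
  have "(\<Sum>k\<in>spec A e. (norm (?F k))\<^sup>2) \<le> (\<Sum>k\<in>spec A e. 4 * (norm (ft (smooth ?B A) k))\<^sup>2)"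
  proof (rule sum_mono)
    fix k assume "k \<in> spec A e"
    then have "norm (ft_bump ?B k - 1) \<le> e" using ft_bump_spec[of ?B A e k] B by (auto simp: spec_def)
    then have "1 / 2 \<le> norm (ft_bump ?B k)"
      using e norm_triangle_ineq2[of 1 "1 - ft_bump ?B k"] by (simp add: norm_minus_commute)
    then have "1 / 2 * norm (?F k) \<le> norm (ft_bump ?B k) * norm (?F k)" by (intro mult_right_mono) auto
    then have "(1 / 2 * norm (?F k))\<^sup>2 \<le> (norm (ft (smooth ?B A) k))\<^sup>2"
      by (intro power_mono) (auto simp: ft_smooth norm_mult)
    then show "(norm (?F k))\<^sup>2 \<le> 4 * (norm (ft (smooth ?B A) k))\<^sup>2"
      by (simp add: power_mult_distrib power_divide)
  qed
  also have "\<dots> \<le> (\<Sum>k\<in>I. 4 * (norm (ft (smooth ?B A) k))\<^sup>2)"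
    by (intro sum_mono2 spec_subset) auto
  also have "\<dots> = 4 * (of_int N * (\<Sum>x\<in>I. (smooth ?B A x)\<^sup>2))"
    by (simp add: sum_distrib_left[symmetric] parseval[OF periodic_smooth])
  also have "\<dots> \<le> 4 * (of_int N * 2)"
  proof -
    have "real (card A) / real (card ?B) \<le> 1" using B by (auto simp: divide_le_eq_1)
    then have "(\<Sum>x\<in>I. (smooth ?B A x)\<^sup>2) \<le> 2"
      using smooth_square_sum_le[OF A bohr_subset B(1)] by linarith
    then show ?thesis using N_pos by (intro mult_left_mono) auto
  qed
  finally show ?thesis by simp
qed

text \<open>\<open>A\<close> is smoothed at level \<open>e1\<close>, the offsets come from the Bohr
  set at level \<open>e0\<close>, and \<open>e2\<close> cuts off negligible frequencies. The
  hypothesis \<open>large\<close> makes the averaging set at least as big as \<open>A\<close>, and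
  \<open>e1\<close> is so small that passing back from the smoothed set costs half of the main term.
  In \<open>9216 = 9 * 1024\<close> the 9 reflects almost invariance with
  \<open>\<theta> = 9 * \<sigma>\<close>, and 1024 comes from
  \<open>popular_correlation\<close>.\<close>

lemma count5_lower_scale:
  fixes d0 d1 e0 e1 e2 \<delta> :: real
  assumes A: "sidon_mod A" and N: "odd N"
    and \<delta>: "0 < \<delta>" "\<delta> * sqrt (of_int N) \<le> card A"
    and \<sigma>: "\<sigma> = \<delta> ^ 4 / 9216"
    and e: "0 < e0" "0 < e1" "0 < e2" "e0\<^sup>2 \<le> \<sigma> / 18"
    and d0: "0 < d0" "d0 * of_int N \<le> card (bohr (spec A e0) e0)"
    and d1: "0 < d1" "d1 * of_int N \<le> card (bohr (spec A e1) e1)"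
    and large: "real (card A) \<le> d1 * of_int N"
    and e2: "e2\<^sup>2 \<le> \<sigma> * d1"
    and e1: "64 * e1 \<le> \<delta> ^ 7 / 32768 * d0 ^ 3"
    and gap: "(\<Sum>k\<in>spec A e2 - spec A e0. (norm (ft (ind A) k))\<^sup>2) \<le> \<sigma> * of_int N"
  shows "\<delta> ^ 7 / 32768 * d0 ^ 3 * (of_int N * sqrt (of_int N)) \<le> count5 (ind A)"
proof -
  let ?C = "bohr (spec A e0) e0" and ?B = "bohr (spec A e1) e1" and ?F = "ft (ind A)"
  let ?f = "smooth ?B A" and ?\<alpha> = "real (card A)" and ?n = "real_of_int N"
  let ?s = "sqrt ?n"
  have n: "?n > 0" using N_pos by simp
  have s: "?s > 0" using n by simp
  have ss: "?s * ?s = ?n" using n by simp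
  have AI: "A \<subseteq> I" using A by (simp add: sidon_mod_def)
  have "0 < \<delta> * ?s" using \<delta> s by simp
  then have \<alpha>: "0 < ?\<alpha>" using \<delta> by linarith
  have "0 < d1 * ?n" using d1 n by simp
  then have cB: "0 < real (card ?B)" using d1 by linarith
  then have neB: "?B \<noteq> {}" by auto
  have \<sigma>0: "0 < \<sigma>" unfolding \<sigma> using \<delta>(1) by simp
  have "?\<alpha> \<le> real (card ?B)" using large d1 by linarith
  then have "?\<alpha> / real (card ?B) \<le> 1" using cB by (simp add: divide_le_eq_1)
  then have energy: "(\<Sum>x\<in>I. (?f x)\<^sup>2) \<le> 2"
    using smooth_square_sum_le[OF A bohr_subset neB] by linarith
  have tail: "(\<Sum>k\<in>I - spec A e0. (norm (ft ?f k))\<^sup>2) \<le> 2 * \<sigma> * ?n"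
  proof -
    let ?g = "\<lambda>k. (norm (ft ?f k))\<^sup>2"
    have sub: "I - spec A e0 \<subseteq> (spec A e2 - spec A e0) \<union> (I - spec A e2)" by auto
    have "(\<Sum>k\<in>I - spec A e0. ?g k) \<le> (\<Sum>k\<in>(spec A e2 - spec A e0) \<union> (I - spec A e2). ?g k)"
      by (intro sum_mono2 sub) auto
    also have "\<dots> = (\<Sum>k\<in>spec A e2 - spec A e0. ?g k) + (\<Sum>k\<in>I - spec A e2. ?g k)"
      by (intro sum.union_disjoint) auto
    also have "(\<Sum>k\<in>spec A e2 - spec A e0. ?g k) \<le> (\<Sum>k\<in>spec A e2 - spec A e0. (norm (?F k))\<^sup>2)"
    proof (rule sum_mono)
      fix k
      have "norm (ft ?f k) \<le> norm (?F k)"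
        using mult_right_mono[OF norm_ft_bump_le_1[OF bohr_subset], of "norm (?F k)"]
        by (simp add: ft_smooth norm_mult)
      then show "?g k \<le> (norm (?F k))\<^sup>2" by (intro power_mono) auto
    qed
    also have "\<dots> \<le> \<sigma> * ?n" by (rule gap)
    \<comment> \<open>Here the coefficients of \<open>A\<close> are small, while the averaging
      weight has total energy \<open>N / card B\<close>, at most \<open>1 / d1\<close>; the choice
      of \<open>e2\<close> compensates for the latter.\<close>
    also have "(\<Sum>k\<in>I - spec A e2. ?g k) \<le> \<sigma> * ?n"
    proof -
      have "(\<Sum>k\<in>I - spec A e2. ?g k) \<le> (\<Sum>k\<in>I - spec A e2. (e2 * ?s)\<^sup>2 * (norm (ft_bump ?B k))\<^sup>2)"
      proof (rule sum_mono)
        fix k assume "k \<in> I - spec A e2"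
        then have "norm (?F k) \<le> e2 * ?s" by (auto simp: spec_def)
        then have "(norm (?F k))\<^sup>2 \<le> (e2 * ?s)\<^sup>2" by (intro power_mono) auto
        then show "?g k \<le> (e2 * ?s)\<^sup>2 * (norm (ft_bump ?B k))\<^sup>2"
          by (simp add: ft_smooth norm_mult power_mult_distrib mult.commute mult_right_mono)
      qed
      also have "\<dots> \<le> (\<Sum>k\<in>I. (e2 * ?s)\<^sup>2 * (norm (ft_bump ?B k))\<^sup>2)"
        by (intro sum_mono2) auto
      also have "\<dots> = (e2\<^sup>2 * ?n) * (?n / card ?B)"
        using n by (simp add: sum_distrib_left[symmetric] sum_norm_ft_bump_square[OF bohr_subset neB] power_mult_distrib)
      also have "\<dots> \<le> (\<sigma> * d1 * ?n) * (1 / d1)"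
      proof (rule mult_mono)
        show "?n / card ?B \<le> 1 / d1" using d1 cB by (simp add: field_simps)
      qed (use e2 n \<sigma>0 d1 in \<open>auto intro: mult_right_mono\<close>)
      also have "\<dots> = \<sigma> * ?n" using d1 by simp
      finally show ?thesis .
    qed
    finally show ?thesis by simp
  qed
  have ap: "(\<Sum>x\<in>I. (?f (x + u) - ?f x)\<^sup>2) \<le> 9 * \<sigma>"
    if rst: "r \<in> ?C" "s \<in> ?C" "t \<in> ?C" and u: "u \<in> {r, s, t, - r - s - t}" for r s t u
  proof -
    have near: "norm (ec (k * u) - 1) \<le> 3 * e0" if k: "k \<in> spec A e0" for k
    proof -
      have k1: "norm (ec (k * b) - 1) \<le> e0" if "b \<in> ?C" for b using that k by (auto simp: bohr_def)
      have "norm (ec (k * (- r - s - t)) - 1) \<le> 3 * e0"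
      proof -
        have "ec (k * (- r - s - t)) = cnj (ec (k * r) * (ec (k * s) * ec (k * t)))"
          by (simp add: ec_add[symmetric] ec_minus[symmetric] algebra_simps)
        then have "norm (ec (k * (- r - s - t)) - 1) = norm (ec (k * r) * (ec (k * s) * ec (k * t)) - 1)"
          by (metis complex_cnj_diff complex_cnj_one complex_mod_cnj)
        also have "ec (k * r) * (ec (k * s) * ec (k * t)) - 1 = ec (k * r) * (ec (k * s) * (ec (k * t) - 1))
            + ec (k * r) * (ec (k * s) - 1) + (ec (k * r) - 1)"
          by (simp add: algebra_simps)
        also have "norm \<dots> \<le> norm (ec (k * r) * (ec (k * s) * (ec (k * t) - 1)))
            + norm (ec (k * r) * (ec (k * s) - 1)) + norm (ec (k * r) - 1)"
          by (intro order_trans[OF norm_triangle_ineq] add_mono norm_triangle_ineq order_refl)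
        also have "\<dots> \<le> 3 * e0" using k1[OF rst(1)] k1[OF rst(2)] k1[OF rst(3)] by (simp add: norm_mult)
        finally show ?thesis .
      qed
      moreover have "norm (ec (k * b) - 1) \<le> 3 * e0" if "b \<in> ?C" for b using k1[OF that] e by linarith
      ultimately show ?thesis using u rst by auto
    qed
    \<comment> \<open>The coarse spectrum contributes \<open>18 * e0\<^sup>2\<close>, at most
      \<open>\<sigma>\<close>, and the tail \<open>8 * \<sigma>\<close>; together
      \<open>9 * \<sigma>\<close>.\<close>
    have "?n * (\<Sum>x\<in>I. (?f (x + u) - ?f x)\<^sup>2) \<le>
        (3 * e0)\<^sup>2 * (?n * (\<Sum>x\<in>I. (?f x)\<^sup>2)) + 4 * (\<Sum>k\<in>I - spec A e0. (norm (ft ?f k))\<^sup>2)"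
      by (rule shift_square_sum_le[OF periodic_smooth spec_subset near])
    also have "\<dots> \<le> (3 * e0)\<^sup>2 * (?n * 2) + 4 * (2 * \<sigma> * ?n)"
      using energy tail n by (intro add_mono mult_left_mono) auto
    also have "\<dots> = ?n * (18 * e0\<^sup>2 + 8 * \<sigma>)" by (simp add: algebra_simps power_mult_distrib)
    also have "\<dots> \<le> ?n * (9 * \<sigma>)" using e n by (intro mult_left_mono) auto
    finally show ?thesis using n by (subst (asm) mult_le_cancel_left) auto
  qed
  have pow: "\<delta> ^ m * ?s ^ m \<le> ?\<alpha> ^ m" for m
    using power_mono[OF \<delta>(2), of m] \<delta> s by (simp add: power_mult_distrib)
  have \<theta>: "1024 * (9 * \<sigma>) * ?n\<^sup>2 \<le> ?\<alpha> ^ 4"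
  proof -
    have "?s ^ 4 = (?s * ?s) * (?s * ?s)" by (simp only: power4_eq_xxxx mult.assoc)
    also have "\<dots> = ?n\<^sup>2" unfolding ss by (simp add: power2_eq_square)
    finally have "1024 * (9 * \<sigma>) * ?n\<^sup>2 = \<delta> ^ 4 * ?s ^ 4" by (simp add: \<sigma>)
    then show ?thesis using pow[of 4] by simp
  qed
  have low: "real (card ?C) ^ 3 * (?\<alpha>\<^sup>2 / 16 * (?\<alpha> / (4 * ?n)) ^ 5) \<le> count5 ?f"
    by (rule count5_lower[OF periodic_smooth smooth_nonneg sum_smooth[OF AI bohr_subset neB] \<alpha> energy
          bohr_subset ap \<theta>])
  \<comment> \<open>\<open>16384 = 16 * 4 ^ 5\<close> is the constant of
    \<open>count5_lower\<close>; the factor 2 reserves half of the count for the smoothing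
    error.\<close>
  have "2 * (\<delta> ^ 7 / 32768 * d0 ^ 3 * (?n * ?s)) = (d0 * ?n) ^ 3 * (\<delta> ^ 7 * ?s ^ 7 / (16384 * ?n ^ 5))"
  proof -
    have "x ^ 7 = x * ((x * x) * (x * x) * (x * x))" for x :: real
      by (simp add: power_numeral_reduce mult_ac)
    from this[of ?s] have "?s ^ 7 = ?s * (?n * ?n * ?n)" unfolding ss .
    then have "?n ^ 3 * ?s ^ 7 = (?n * ?s) * ?n ^ 5"
      by (simp add: power_numeral_reduce mult_ac)
    then have eq: "?n ^ 3 * ?s ^ 7 / ?n ^ 5 = ?n * ?s" using n by (simp add: field_simps)
    have "(d0 * ?n) ^ 3 * (\<delta> ^ 7 * ?s ^ 7 / (16384 * ?n ^ 5)) =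
        \<delta> ^ 7 / 16384 * d0 ^ 3 * (?n ^ 3 * ?s ^ 7 / ?n ^ 5)"
      by (simp add: power_mult_distrib mult_ac)
    then show ?thesis unfolding eq by simp
  qed
  also have "\<dots> \<le> real (card ?C) ^ 3 * (?\<alpha> ^ 7 / (16384 * ?n ^ 5))"
    using d0 n \<delta> s pow[of 7] by (intro mult_mono power_mono divide_right_mono) auto
  also have "\<dots> = real (card ?C) ^ 3 * (?\<alpha>\<^sup>2 / 16 * (?\<alpha> / (4 * ?n)) ^ 5)"
    by (simp add: power_divide power_mult_distrib power_numeral_reduce mult_ac)
  also have "\<dots> \<le> count5 ?f" by (rule low)
  finally have main: "2 * (\<delta> ^ 7 / 32768 * d0 ^ 3 * (?n * ?s)) \<le> count5 ?f" .
  have "\<bar>count5 (ind A) - count5 ?f\<bar> \<le> 64 * e1 * (?n * ?s)"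
    by (rule count5_smooth_close[OF A N e(2) order_refl neB])
  also have "\<dots> \<le> \<delta> ^ 7 / 32768 * d0 ^ 3 * (?n * ?s)"
    using e1 n s by (intro mult_right_mono) auto
  finally show ?thesis using main by linarith
qed

end

text \<open>The size of the spectrum, and with it the number of cells in the pigeonhole bound, is
  controlled by \<open>e\<close> alone. The statement lives outside the locale so that
  \<open>d\<close> is chosen before \<open>N\<close> and \<open>A\<close>.\<close>

lemma bohr_spec_density:
  assumes "0 < e"
  shows "\<exists>d>0. \<forall>N A. cyclic N \<longrightarrow> cyclic.sidon_mod N A \<longrightarrow>
    d * of_int N \<le> real (card (cyclic.bohr N (cyclic.spec N A e) e))"
proof -
  obtain m :: nat where m: "2 * pi / e < real m" using reals_Archimedean2 by blast
  have "0 < 2 * pi / e" using assms by simp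
  then have m0: "0 < m" using m by (metis less_trans of_nat_0_less_iff)
  have me: "2 * pi / real m \<le> e" using m m0 assms by (simp add: field_simps)
  define K where "K = nat \<lfloor>4 / e ^ 4\<rfloor>"
  have "1 / real m ^ K * of_int N \<le> real (card (cyclic.bohr N (cyclic.spec N A e) e))"
    if N: "cyclic N" and A: "cyclic.sidon_mod N A" for N A
  proof -
    interpret cyclic N by (rule N)
    have "card (spec A e) \<le> K"
      using card_spec_le[OF A assms] unfolding K_def by (simp add: le_nat_floor)
    then have "real m ^ card (spec A e) \<le> real m ^ K" using m0 by (intro power_increasing) auto
    moreover have "card (bohr (spec A e) (2 * pi / real m)) \<le> card (bohr (spec A e) e)"
      by (intro card_mono finite_bohr bohr_mono me)
    ultimately have "real (card (bohr (spec A e) (2 * pi / real m))) * real m ^ card (spec A e)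
        \<le> real (card (bohr (spec A e) e)) * real m ^ K"
      by (intro mult_mono) auto
    then have "of_int N \<le> real (card (bohr (spec A e) e)) * real m ^ K"
      using card_bohr_ge[OF finite_spec m0, of A e] by linarith
    then show ?thesis using m0 by (simp add: field_simps)
  qed
  then show ?thesis using m0 by (intro exI[of _ "1 / real m ^ K"]) auto
qed

text \<open>Pigeonhole over levels: the energy on the spectra at the even levels
  \<open>2 * j\<close> stays below \<open>8 * N\<close>, so some step from \<open>j\<close> to
  \<open>j + 1\<close> adds at most \<open>\<sigma> * N\<close>. The odd level in between is the
  smoothing scale. All levels are fixed from \<open>\<delta>\<close> in advance, which makes
  \<open>c\<close> uniform.\<close>

theorem sidon_many_solutions:
  assumes \<delta>: "0 < (\<delta>::real)"
  shows "\<exists>c>0. \<exists>N0::real. \<forall>N A. cyclic N \<longrightarrow> odd N \<longrightarrow> N0 \<le> of_int N \<longrightarrow> cyclic.sidon_mod N A \<longrightarrow>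
    \<delta> * sqrt (of_int N) \<le> card A \<longrightarrow> c * (of_int N * sqrt (of_int N)) \<le> cyclic.count5 N (cyclic.ind N A)"
proof -
  define \<sigma> where "\<sigma> = \<delta> ^ 4 / 9216"
  have \<sigma>: "0 < \<sigma>" using \<delta> by (simp add: \<sigma>_def)
  obtain dens where dens: "\<And>e. 0 < e \<Longrightarrow> 0 < dens e" "\<And>e N A. 0 < e \<Longrightarrow> cyclic N \<Longrightarrow>
      cyclic.sidon_mod N A \<Longrightarrow> dens e * of_int N \<le> real (card (cyclic.bohr N (cyclic.spec N A e) e))"
    using bohr_spec_density by metis
  \<comment> \<open>The square root serves the condition relating \<open>e2\<close> to
    \<open>e1\<close>, the cubic term the one relating \<open>e1\<close> to \<open>e0\<close>.
    Imposing both at each step makes any three consecutive levels admissible.\<close>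
  define nxt where "nxt e = min e (min (sqrt (\<sigma> * dens e)) (\<delta> ^ 7 / 32768 * dens e ^ 3 / 64))" for e
  define \<eta> where "\<eta> k = (nxt ^^ k) (min (1 / 2) (sqrt (\<sigma> / 18)))" for k
  have \<eta>_Suc: "\<eta> (Suc k) = nxt (\<eta> k)" for k by (simp add: \<eta>_def)
  have \<eta>_pos: "0 < \<eta> k" for k
  proof (induction k)
    case 0 then show ?case using \<sigma> by (simp add: \<eta>_def)
  next
    case (Suc k)
    then show ?case using dens(1)[OF Suc] \<sigma> \<delta> by (simp add: \<eta>_Suc nxt_def)
  qed
  have dpos: "0 < dens (\<eta> k)" for k by (rule dens(1)[OF \<eta>_pos])
  have dec: "\<eta> (Suc k) \<le> \<eta> k" for k by (simp add: \<eta>_Suc nxt_def)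
  have \<eta>_le0: "\<eta> k \<le> \<eta> 0" for k by (rule lift_Suc_antimono_le[of \<eta>, OF dec]) simp
  have \<eta>_half: "\<eta> k \<le> 1 / 2" and \<eta>_sq: "(\<eta> k)\<^sup>2 \<le> \<sigma> / 18" for k
  proof -
    show "\<eta> k \<le> 1 / 2" using \<eta>_le0[of k] by (simp add: \<eta>_def)
    have "\<eta> k \<le> sqrt (\<sigma> / 18)" using \<eta>_le0[of k] by (simp add: \<eta>_def)
    then have "(\<eta> k)\<^sup>2 \<le> (sqrt (\<sigma> / 18))\<^sup>2" using \<eta>_pos[of k] by (intro power_mono) auto
    then show "(\<eta> k)\<^sup>2 \<le> \<sigma> / 18" using \<sigma> by simp
  qed
  have nxt_sq: "(\<eta> (Suc k))\<^sup>2 \<le> \<sigma> * dens (\<eta> k)" for k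
  proof -
    have "\<eta> (Suc k) \<le> sqrt (\<sigma> * dens (\<eta> k))" by (simp add: \<eta>_Suc nxt_def)
    then have "(\<eta> (Suc k))\<^sup>2 \<le> (sqrt (\<sigma> * dens (\<eta> k)))\<^sup>2"
      using \<eta>_pos[of "Suc k"] by (intro power_mono) auto
    then show ?thesis using \<sigma> dpos[of k] by simp
  qed
  have nxt_lin: "64 * \<eta> (Suc k) \<le> \<delta> ^ 7 / 32768 * dens (\<eta> k) ^ 3" for k
    by (simp add: \<eta>_Suc nxt_def)
  \<comment> \<open>With \<open>J\<close> increments above \<open>\<sigma> * N\<close> the energy
    would exceed \<open>8 * N\<close>.\<close>
  obtain J :: nat where J: "8 / \<sigma> < real J" using reals_Archimedean2 by blast
  define D where "D = Min ((\<lambda>k. dens (\<eta> k)) ` {..2 * J})"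
  have D: "0 < D" "\<And>k. k \<le> 2 * J \<Longrightarrow> D \<le> dens (\<eta> k)"
    unfolding D_def using dpos by (auto simp: Min_gr_iff)
  define c where "c = \<delta> ^ 7 / 32768 * D ^ 3"
  have "c * (of_int N * sqrt (of_int N)) \<le> cyclic.count5 N (cyclic.ind N A)"
    if N: "cyclic N" and odd: "odd N" and large: "2 / D\<^sup>2 \<le> of_int N" and A: "cyclic.sidon_mod N A"
      and dense: "\<delta> * sqrt (of_int N) \<le> card A" for N A
  proof -
    interpret cyclic N by (rule N)
    let ?n = "real_of_int N"
    have n: "?n > 0" using N_pos by simp
    have dens': "dens (\<eta> k) * ?n \<le> real (card (bohr (spec A (\<eta> k)) (\<eta> k)))" for k
      by (rule dens(2)[OF \<eta>_pos N A])
    \<comment> \<open>The threshold \<open>2 / D\<^sup>2\<close> for \<open>N\<close> is where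
      \<open>sqrt (2 * N)\<close>, the bound for \<open>card A\<close>, drops to
      \<open>D * N\<close>.\<close>
    have small: "real (card A) \<le> dens (\<eta> k) * ?n" if "k \<le> 2 * J" for k
    proof -
      have "(real (card A))\<^sup>2 \<le> 2 * ?n" by (rule sidon_card_le[OF A])
      also have "\<dots> \<le> (D\<^sup>2 * ?n) * ?n"
        using large D n by (intro mult_right_mono) (auto simp: field_simps)
      also have "\<dots> = (D * ?n)\<^sup>2" by (simp add: power2_eq_square)
      finally have "real (card A) \<le> D * ?n" by (rule power2_le_imp_le) (use D n in simp)
      also have "\<dots> \<le> dens (\<eta> k) * ?n" using D(2)[OF that] n by (intro mult_right_mono) auto
      finally show ?thesis .
    qed
    define E where "E j = (\<Sum>k\<in>spec A (\<eta> (2 * j)). (norm (ft (ind A) k))\<^sup>2)" for j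
    have "\<exists>j<J. E (Suc j) - E j \<le> \<sigma> * ?n"
    proof (rule ccontr)
      assume "\<not> ?thesis"
      then have inc: "\<sigma> * ?n < E (Suc j) - E j" if "j < J" for j using that by auto
      have "real j * (\<sigma> * ?n) \<le> E j" if "j \<le> J" for j
        using that
      proof (induction j)
        case 0 then show ?case by (simp add: E_def sum_nonneg)
      next
        case (Suc j)
        then show ?case using inc[of j] by (simp add: algebra_simps)
      qed
      from this[of J] have "real J * (\<sigma> * ?n) \<le> E J" by simp
      moreover have "E J \<le> 8 * ?n"
      proof -
        have "0 < dens (\<eta> (2 * J)) * ?n" using dpos n by simp
        then have "0 < real (card (bohr (spec A (\<eta> (2 * J))) (\<eta> (2 * J))))" using dens' by (rule less_le_trans)
        then have "bohr (spec A (\<eta> (2 * J))) (\<eta> (2 * J)) \<noteq> {}" by auto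
        moreover have "card A \<le> card (bohr (spec A (\<eta> (2 * J))) (\<eta> (2 * J)))"
          using small[of "2 * J"] dens'[of "2 * J"] by linarith
        ultimately show ?thesis
          unfolding E_def by (intro energy_spec_le[OF A \<eta>_pos \<eta>_half])
      qed
      moreover have "8 * ?n < real J * \<sigma> * ?n"
        using J \<sigma> n by (intro mult_strict_right_mono) (auto simp: field_simps)
      ultimately show False by (simp add: mult.assoc)
    qed
    then obtain j where j: "j < J" "E (Suc j) - E j \<le> \<sigma> * ?n" by blast
    let ?k = "2 * j"
    have "\<eta> (Suc (Suc ?k)) \<le> \<eta> ?k" using dec[of ?k] dec[of "Suc ?k"] by linarith
    then have sub: "spec A (\<eta> ?k) \<subseteq> spec A (\<eta> (Suc (Suc ?k)))" by (rule spec_mono)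
    have gap: "(\<Sum>k\<in>spec A (\<eta> (Suc (Suc ?k))) - spec A (\<eta> ?k). (norm (ft (ind A) k))\<^sup>2) \<le> \<sigma> * ?n"
      using j(2) by (simp add: E_def sum_diff[OF finite_spec sub])
    have "\<delta> ^ 7 / 32768 * dens (\<eta> ?k) ^ 3 * (?n * sqrt ?n) \<le> count5 (ind A)"
    proof (rule count5_lower_scale[OF A odd \<delta> dense \<sigma>_def])
      show "real (card A) \<le> dens (\<eta> (Suc ?k)) * ?n" using small j by simp
    qed (rule \<eta>_pos \<eta>_sq dpos dens' nxt_sq nxt_lin gap)+
    moreover have "c * (?n * sqrt ?n) \<le> \<delta> ^ 7 / 32768 * dens (\<eta> ?k) ^ 3 * (?n * sqrt ?n)"
      unfolding c_def using D j \<delta> n by (intro mult_right_mono mult_left_mono power_mono) auto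
    ultimately show ?thesis by linarith
  qed
  moreover have "0 < c" using D \<delta> by (simp add: c_def)
  ultimately show ?thesis by blast
qed

section \<open>The upper bound\<close>

context cyclic
begin

lemma conv_conv_ind:
  assumes AI: "A \<subseteq> I" and h: "periodic h"
  shows "conv (conv (ind A) (ind A)) h w = (\<Sum>p\<in>A. \<Sum>q\<in>A. h (w - p - q))"
proof -
  have per: "periodic (\<lambda>u. ind A (u - p) * h (w - u))" for p
    using h periodic_ind[of A] unfolding periodic_def by (metis mod_diff_left_eq mod_diff_right_eq)
  have inner: "(\<Sum>u\<in>I. ind A (u - p) * h (w - u)) = (\<Sum>q\<in>A. h (w - p - q))" for p
    using sum_shift[OF per[of p], of p] sum_ind_mult[OF AI, of "\<lambda>q. h (w - p - q)"]
    by (simp add: algebra_simps)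
  have "conv (conv (ind A) (ind A)) h w = (\<Sum>u\<in>I. \<Sum>p\<in>A. ind A (u - p) * h (w - u))"
    by (simp add: conv_def[of "conv _ _"] conv_ind[OF AI] sum_distrib_right)
  also have "\<dots> = (\<Sum>p\<in>A. \<Sum>u\<in>I. ind A (u - p) * h (w - u))" by (rule sum.swap)
  finally show ?thesis by (simp add: inner)
qed

lemma count5_ind:
  assumes AI: "A \<subseteq> I"
  shows "count5 (ind A) = (\<Sum>x\<in>A. \<Sum>p\<in>A. \<Sum>q\<in>A. \<Sum>r\<in>A. ind A (4 * x - p - q - r))"
proof -
  have "count5 (ind A) = (\<Sum>x\<in>A. conv (conv (ind A) (ind A)) (conv (ind A) (ind A)) (4 * x))"
    using sum_ind_mult[OF AI, of "\<lambda>x. conv (conv (ind A) (ind A)) (conv (ind A) (ind A)) (4 * x)"]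
    by (simp add: count5_def)
  then show ?thesis
    by (simp add: conv_conv_ind[OF AI periodic_conv] conv_ind[OF AI])
qed

end

text \<open>Two of the five entries of every solution coincide. For each of the ten coincidences,
  \<open>x\<close> and one further entry \<open>y\<close> are free, and the remaining two entries
  have a prescribed sum, which by the Sidon property determines them up to order: at most
  \<open>2 * (card A)\<^sup>2\<close> solutions per coincidence.\<close>

lemma degenerate_solutions_card_le:
  assumes fin: "finite A" and A: "sidon A" "no_four_avg A"
  shows "card {(x, p, q, r). x \<in> A \<and> p \<in> A \<and> q \<in> A \<and> r \<in> A \<and> 4 * x - p - q - r \<in> A} \<le> 20 * (card A)\<^sup>2"
    (is "card ?Q \<le> _")
proof -
  \<comment> \<open>\<open>pick w\<close> is one chosen representation of \<open>w\<close> as a sum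
    of two elements of \<open>A\<close>, arbitrary if there is none; the Boolean in \<open>g\<close>
    selects one of its entries.\<close>
  define pick where "pick w = (SOME z. fst z \<in> A \<and> snd z \<in> A \<and> fst z + snd z = w)" for w
  define g where "g b w = (if b then fst (pick w) else snd (pick w))" for b w
  have g: "\<exists>b. u = g b w \<and> v = g (\<not> b) w" if uv: "u \<in> A" "v \<in> A" "u + v = w" for u v w
  proof -
    have "\<exists>z. fst z \<in> A \<and> snd z \<in> A \<and> fst z + snd z = w" using uv by (intro exI[of _ "(u, v)"]) simp
    then have "fst (pick w) \<in> A \<and> snd (pick w) \<in> A \<and> fst (pick w) + snd (pick w) = w"
      unfolding pick_def by (rule someI_ex)
    then have "{u, v} = {fst (pick w), snd (pick w)}" using A(1) uv unfolding sidon_def by blast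
    then have "(u = fst (pick w) \<and> v = snd (pick w)) \<or> (u = snd (pick w) \<and> v = fst (pick w))"
      by (metis doubleton_eq_iff)
    then show ?thesis
      by (metis (full_types) g_def)
  qed
  let ?X = "A \<times> A \<times> (UNIV :: bool set)"
  \<comment> \<open>One parametrisation for each coincidence among \<open>p\<close>,
    \<open>q\<close>, \<open>r\<close>, \<open>s\<close>, \<open>x\<close>; the entry
    \<open>s\<close> is determined by the others and not recorded.\<close>
  define \<F> where "\<F> = set [\<lambda>(x, y, b). (x, y, y, g b (4 * x - 2 * y)), \<lambda>(x, y, b). (x, y, g b (4 * x - 2 * y), y),
    \<lambda>(x, y, b). (x, g b (4 * x - 2 * y), y, y), \<lambda>(x, y, b). (x, y, g b (4 * x - 2 * y), g (\<not> b) (4 * x - 2 * y)),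
    \<lambda>(x, y, b). (x, g b (4 * x - 2 * y), y, g (\<not> b) (4 * x - 2 * y)),
    \<lambda>(x, y, b). (x, g b (4 * x - 2 * y), g (\<not> b) (4 * x - 2 * y), y),
    \<lambda>(x, y, b). (x, x, y, g b (3 * x - y)), \<lambda>(x, y, b). (x, y, x, g b (3 * x - y)),
    \<lambda>(x, y, b). (x, y, g b (3 * x - y), x), \<lambda>(x, y, b). (x, y, g b (3 * x - y), g (\<not> b) (3 * x - y))]"
  have "?Q \<subseteq> (\<Union>F\<in>\<F>. F ` ?X)"
  proof
    fix z assume "z \<in> ?Q"
    then obtain x p q r where z: "z = (x, p, q, r)" and in_A: "x \<in> A" "p \<in> A" "q \<in> A" "r \<in> A"
      and s: "4 * x - p - q - r \<in> A" by auto
    define s where "s = 4 * x - p - q - r"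
    have sA: "s \<in> A" and eq: "p + q + r + s = 4 * x" using s by (auto simp: s_def)
    have "\<not> distinct [p, q, r, s, x]" using A(2) in_A sA eq unfolding no_four_avg_def by blast
    then consider "p = q" | "p = r" | "q = r" | "p = s" | "q = s" | "r = s"
      | "p = x" | "q = x" | "r = x" | "s = x" by auto
    then show "z \<in> (\<Union>F\<in>\<F>. F ` ?X)"
    proof cases
      case 1
      obtain b where "r = g b (4 * x - 2 * p)" using g[of r s "4 * x - 2 * p"] in_A sA eq 1 by auto
      then have "z = (\<lambda>(x, y, b). (x, y, y, g b (4 * x - 2 * y))) (x, p, b)" using z 1 by simp
      then show ?thesis using in_A unfolding \<F>_def list.set by blast
    next
      case 2
      obtain b where "q = g b (4 * x - 2 * p)" using g[of q s "4 * x - 2 * p"] in_A sA eq 2 by auto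
      then have "z = (\<lambda>(x, y, b). (x, y, g b (4 * x - 2 * y), y)) (x, p, b)" using z 2 by simp
      then show ?thesis using in_A unfolding \<F>_def list.set by blast
    next
      case 3
      obtain b where "p = g b (4 * x - 2 * q)" using g[of p s "4 * x - 2 * q"] in_A sA eq 3 by auto
      then have "z = (\<lambda>(x, y, b). (x, g b (4 * x - 2 * y), y, y)) (x, q, b)" using z 3 by simp
      then show ?thesis using in_A unfolding \<F>_def list.set by blast
    next
      case 4
      obtain b where "q = g b (4 * x - 2 * p)" "r = g (\<not> b) (4 * x - 2 * p)"
        using g[of q r "4 * x - 2 * p"] in_A sA eq 4 by auto
      then have "z = (\<lambda>(x, y, b). (x, y, g b (4 * x - 2 * y), g (\<not> b) (4 * x - 2 * y))) (x, p, b)" using z 4 by simp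
      then show ?thesis using in_A unfolding \<F>_def list.set by blast
    next
      case 5
      obtain b where "p = g b (4 * x - 2 * q)" "r = g (\<not> b) (4 * x - 2 * q)"
        using g[of p r "4 * x - 2 * q"] in_A sA eq 5 by auto
      then have "z = (\<lambda>(x, y, b). (x, g b (4 * x - 2 * y), y, g (\<not> b) (4 * x - 2 * y))) (x, q, b)" using z 5 by simp
      then show ?thesis using in_A unfolding \<F>_def list.set by blast
    next
      case 6
      obtain b where "p = g b (4 * x - 2 * r)" "q = g (\<not> b) (4 * x - 2 * r)"
        using g[of p q "4 * x - 2 * r"] in_A sA eq 6 by auto
      then have "z = (\<lambda>(x, y, b). (x, g b (4 * x - 2 * y), g (\<not> b) (4 * x - 2 * y), y)) (x, r, b)" using z 6 by simp
      then show ?thesis using in_A unfolding \<F>_def list.set by blast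
    next
      case 7
      obtain b where "r = g b (3 * x - q)" using g[of r s "3 * x - q"] in_A sA eq 7 by auto
      then have "z = (\<lambda>(x, y, b). (x, x, y, g b (3 * x - y))) (x, q, b)" using z 7 by simp
      then show ?thesis using in_A unfolding \<F>_def list.set by blast
    next
      case 8
      obtain b where "r = g b (3 * x - p)" using g[of r s "3 * x - p"] in_A sA eq 8 by auto
      then have "z = (\<lambda>(x, y, b). (x, y, x, g b (3 * x - y))) (x, p, b)" using z 8 by simp
      then show ?thesis using in_A unfolding \<F>_def list.set by blast
    next
      case 9
      obtain b where "q = g b (3 * x - p)" using g[of q s "3 * x - p"] in_A sA eq 9 by auto
      then have "z = (\<lambda>(x, y, b). (x, y, g b (3 * x - y), x)) (x, p, b)" using z 9 by simp
      then show ?thesis using in_A unfolding \<F>_def list.set by blast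
    next
      case 10
      obtain b where "q = g b (3 * x - p)" "r = g (\<not> b) (3 * x - p)"
        using g[of q r "3 * x - p"] in_A sA eq 10 by auto
      then have "z = (\<lambda>(x, y, b). (x, y, g b (3 * x - y), g (\<not> b) (3 * x - y))) (x, p, b)" using z by simp
      then show ?thesis using in_A unfolding \<F>_def list.set by blast
    qed
  qed
  moreover have finF: "finite \<F>" by (simp add: \<F>_def)
  moreover have finX: "finite ?X" using fin by simp
  ultimately have "card ?Q \<le> card (\<Union>F\<in>\<F>. F ` ?X)" by (intro card_mono) auto
  also have "\<dots> \<le> (\<Sum>F\<in>\<F>. card (F ` ?X))" by (rule card_UN_le[OF finF])
  also have "\<dots> \<le> (\<Sum>F\<in>\<F>. card ?X)" by (intro sum_mono card_image_le finX)
  also have "\<dots> = card \<F> * (2 * (card A)\<^sup>2)"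
    by (simp add: card_cartesian_product power2_eq_square)
  also have "\<dots> \<le> 10 * (2 * (card A)\<^sup>2)"
    unfolding \<F>_def by (rule mult_le_mono1, rule order_trans[OF card_length]) simp
  finally show ?thesis by simp
qed

text \<open>For entries in \<open>{1..n}\<close>, the value \<open>4 * x - p - q - r\<close> differs
  from an element of \<open>A\<close> by at most \<open>4 * n - 4\<close>, and two sums of pairs
  differ by even less. All congruences modulo \<open>N\<close> in question are therefore equalities
  of integers.\<close>

lemma sidon_modulo_count5_le:
  assumes n: "0 < n" and A: "A \<subseteq> {1..int n}" "sidon A" "no_four_avg A"
  defines "N \<equiv> 4 * int n + 1"
  shows "cyclic.sidon_mod N A" and "cyclic.count5 N (cyclic.ind N A) \<le> 20 * (real (card A))\<^sup>2"
proof -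
  interpret cyclic N by unfold_locales (simp add: N_def)
  have AI: "A \<subseteq> I" using A(1) by (auto simp: N_def)
  have fin: "finite A" using A(1) finite_subset by blast
  have small: "x = y" if "x mod N = y mod N" "\<bar>x - y\<bar> < N" for x y
  proof -
    have "N dvd x - y" using that(1) by (simp add: mod_eq_dvd_iff)
    then show ?thesis using that(2) dvd_imp_le_int[of "x - y" N] by (cases "x = y") auto
  qed
  have bnd: "1 \<le> x" "x \<le> int n" if "x \<in> A" for x using A(1) that by auto
  have "{x1, x2} = {x3, x4}" if "x1 \<in> A" "x2 \<in> A" "x3 \<in> A" "x4 \<in> A" "(x1 + x2) mod N = (x3 + x4) mod N"
    for x1 x2 x3 x4
  proof -
    have "x1 + x2 = x3 + x4"
      using small[OF that(5)] bnd[OF that(1)] bnd[OF that(2)] bnd[OF that(3)] bnd[OF that(4)]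
      by (simp add: N_def)
    then show ?thesis using A(2) that unfolding sidon_def by blast
  qed
  then show "sidon_mod A" using AI unfolding sidon_mod_def by blast
  let ?Q = "{(x, p, q, r). x \<in> A \<and> p \<in> A \<and> q \<in> A \<and> r \<in> A \<and> 4 * x - p - q - r \<in> A}"
  have ind_eq: "ind A (4 * x - p - q - r) = (if (x, p, q, r) \<in> ?Q then 1 else 0)"
    if "x \<in> A" "p \<in> A" "q \<in> A" "r \<in> A" for x p q r
  proof -
    have "(4 * x - p - q - r) mod N \<in> A \<longleftrightarrow> 4 * x - p - q - r \<in> A"
    proof
      assume *: "(4 * x - p - q - r) mod N \<in> A"
      have "(4 * x - p - q - r) mod N = 4 * x - p - q - r"
        by (rule small) (use bnd[OF *] bnd[OF that(1)] bnd[OF that(2)] bnd[OF that(3)] bnd[OF that(4)] in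
            \<open>auto simp: N_def\<close>)
      then show "4 * x - p - q - r \<in> A" using * by simp
    next
      assume *: "4 * x - p - q - r \<in> A"
      then have "(4 * x - p - q - r) mod N = 4 * x - p - q - r" using AI by (intro mod_pos_pos_trivial) auto
      then show "(4 * x - p - q - r) mod N \<in> A" using * by simp
    qed
    then show ?thesis using that by (simp add: ind_def)
  qed
  have "count5 (ind A) = (\<Sum>x\<in>A. \<Sum>p\<in>A. \<Sum>q\<in>A. \<Sum>r\<in>A. if (x, p, q, r) \<in> ?Q then 1 else 0)"
    unfolding count5_ind[OF AI] by (intro sum.cong refl ind_eq)
  also have "\<dots> = (\<Sum>z\<in>A \<times> A \<times> A \<times> A. if z \<in> ?Q then 1 else 0)"
    unfolding sum.cartesian_product by (intro sum.cong) (auto simp: split_def)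
  also have "\<dots> = real (card ((A \<times> A \<times> A \<times> A) \<inter> ?Q))"
    using fin by (simp add: sum.If_cases)
  also have "(A \<times> A \<times> A \<times> A) \<inter> ?Q = ?Q" by auto
  also have "real (card ?Q) \<le> real (20 * (card A)\<^sup>2)"
    using degenerate_solutions_card_le[OF fin A(2,3)] by (simp only: of_nat_le_iff)
  finally show "count5 (ind A) \<le> 20 * (real (card A))\<^sup>2" by simp
qed

lemma S_attained:
  obtains A where "A \<subseteq> {1..int n}" "sidon A" "no_four_avg A" "card A = S n"
proof -
  let ?F = "{A. A \<subseteq> {1..int n} \<and> sidon A \<and> no_four_avg A}"
  have "finite ?F" by (rule finite_subset[of _ "Pow {1..int n}"]) auto
  moreover have "{} \<in> ?F" by (simp add: sidon_def no_four_avg_def)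
  ultimately have "S n \<in> card ` ?F" unfolding S_def by (intro Max_in) auto
  then show ?thesis using that by auto
qed

lemma S_ge:
  assumes "A \<subseteq> {1..int n}" "sidon A" "no_four_avg A"
  shows "card A \<le> S n"
proof -
  have "finite {A. A \<subseteq> {1..int n} \<and> sidon A \<and> no_four_avg A}"
    by (rule finite_subset[of _ "Pow {1..int n}"]) auto
  then show ?thesis unfolding S_def using assms by (intro Max_ge) auto
qed

theorem S_upper: "(\<lambda>n. real (S n) / sqrt (real n)) \<longlonglongrightarrow> 0"
proof (rule LIMSEQ_I)
  fix \<delta> :: real assume \<delta>: "0 < \<delta>"
  \<comment> \<open>The factor 3 is lost in passing from \<open>sqrt n\<close> to
    \<open>sqrt N\<close>, through \<open>4 * n + 1 \<le> 9 * n\<close>.\<close>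
  then have "0 < \<delta> / 3" by simp
  from sidon_many_solutions[OF this] obtain c N0 where c: "0 < c"
    and many: "\<And>N A. cyclic N \<Longrightarrow> odd N \<Longrightarrow> N0 \<le> real_of_int N \<Longrightarrow> cyclic.sidon_mod N A \<Longrightarrow>
      \<delta> / 3 * sqrt (of_int N) \<le> card A \<Longrightarrow>
      c * (of_int N * sqrt (of_int N)) \<le> cyclic.count5 N (cyclic.ind N A)"
    by blast
  \<comment> \<open>41 exceeds \<open>20 * 2\<close>, the product of the constants in the bound for
    the solutions and in \<open>sidon_card_le\<close>.\<close>
  obtain n0 :: nat where n0: "max N0 ((41 / c)\<^sup>2) < real n0" using reals_Archimedean2 by blast
  show "\<exists>n0. \<forall>n\<ge>n0. norm (real (S n) / sqrt (real n) - 0) < \<delta>"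
  proof (intro exI[of _ "Suc n0"] allI impI)
    fix n assume n: "Suc n0 \<le> n"
    show "norm (real (S n) / sqrt (real n) - 0) < \<delta>"
    proof (rule ccontr)
      assume "\<not> ?thesis"
      then have big: "\<delta> * sqrt (real n) \<le> real (S n)" using n by (simp add: field_simps)
      obtain A where A: "A \<subseteq> {1..int n}" "sidon A" "no_four_avg A" "card A = S n" by (rule S_attained)
      let ?N = "4 * int n + 1"
      interpret cyclic ?N by unfold_locales simp
      have n1: "0 < n" using n by simp
      have mod: "sidon_mod A" and le: "count5 (ind A) \<le> 20 * (real (card A))\<^sup>2"
        using sidon_modulo_count5_le[OF n1 A(1-3)] by auto
      have "sqrt (real_of_int ?N) \<le> sqrt (9 * real n)" using n1 by (intro real_sqrt_le_mono) simp
      also have "\<dots> = 3 * sqrt (real n)" by (simp add: real_sqrt_mult)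
      finally have "\<delta> / 3 * sqrt (real_of_int ?N) \<le> \<delta> / 3 * (3 * sqrt (real n))"
        using \<delta> by (intro mult_left_mono) auto
      then have dense: "\<delta> / 3 * sqrt (real_of_int ?N) \<le> card A" using big A(4) by simp
      have Nn: "real n0 < real_of_int ?N" using n by simp
      have "c * (real_of_int ?N * sqrt ?N) \<le> count5 (ind A)"
        using n0 Nn by (intro many cyclic_axioms mod dense) auto
      also have "\<dots> \<le> 20 * (2 * real_of_int ?N)" using le sidon_card_le[OF mod] by linarith
      finally have "(c * sqrt ?N) * real_of_int ?N \<le> 40 * real_of_int ?N" by (simp add: algebra_simps)
      then have "c * sqrt ?N \<le> 40" by (subst (asm) mult_le_cancel_right) auto
      moreover have "41 / c < sqrt ?N"
        using n0 Nn c by (intro real_less_rsqrt) auto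
      ultimately show False using c by (simp add: field_simps)
    qed
  qed
qed

section \<open>Behrend sets\<close>

lemma digits_unique:
  fixes y z :: "nat \<Rightarrow> nat"
  assumes "\<And>i. i < d \<Longrightarrow> y i < b" "\<And>i. i < d \<Longrightarrow> z i < b"
    and "(\<Sum>i<d. y i * b ^ i) = (\<Sum>i<d. z i * b ^ i)"
  shows "\<forall>i<d. y i = z i"
  using assms
proof (induction d arbitrary: y z)
  case (Suc d)
  have exp: "(\<Sum>i<Suc d. w i * b ^ i) = w 0 + b * (\<Sum>i<d. w (Suc i) * b ^ i)" for w :: "nat \<Rightarrow> nat"
    by (simp add: sum.lessThan_Suc_shift sum_distrib_left mult_ac del: sum.lessThan_Suc)
  have eq: "y 0 + b * (\<Sum>i<d. y (Suc i) * b ^ i) = z 0 + b * (\<Sum>i<d. z (Suc i) * b ^ i)"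
    using Suc.prems(3) unfolding exp .
  have lt: "y 0 < b" "z 0 < b" using Suc.prems by auto
  have "(y 0 + b * (\<Sum>i<d. y (Suc i) * b ^ i)) mod b = (z 0 + b * (\<Sum>i<d. z (Suc i) * b ^ i)) mod b"
    by (simp only: eq)
  then have y0: "y 0 = z 0" using lt by simp
  then have "(\<Sum>i<d. y (Suc i) * b ^ i) = (\<Sum>i<d. z (Suc i) * b ^ i)" using eq lt by simp
  then have "\<forall>i<d. y (Suc i) = z (Suc i)" using Suc.prems by (intro Suc.IH) auto
  then show ?case using y0 by (auto simp: less_Suc_eq_0_disj)
qed simp

lemma digits_less:
  fixes y :: "nat \<Rightarrow> nat"
  assumes "\<And>i. i < d \<Longrightarrow> y i < b"
  shows "(\<Sum>i<d. y i * b ^ i) < b ^ d"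
  using assms
proof (induction d)
  case (Suc d)
  have "(\<Sum>i<Suc d. y i * b ^ i) < b ^ d + y d * b ^ d" using Suc by simp
  also have "\<dots> = (y d + 1) * b ^ d" by simp
  also have "\<dots> \<le> b * b ^ d" using Suc.prems[of d] by (intro mult_le_mono1) simp
  finally show ?case by simp
qed simp

text \<open>Behrend's construction: a point on a sphere is not the mean of four others.\<close>

lemma behrend_four_avg:
  fixes m d :: nat
  assumes m: "0 < m" and d: "0 < d"
  shows "\<exists>T\<subseteq>{..<(4 * m) ^ d}. m ^ d \<le> card T * (d * m\<^sup>2) \<and>
    (\<forall>x1\<in>T. \<forall>x2\<in>T. \<forall>x3\<in>T. \<forall>x4\<in>T. \<forall>x5\<in>T. x1 + x2 + x3 + x4 = 4 * x5 \<longrightarrow> x1 = x2)"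
proof -
  let ?V = "{..<d} \<rightarrow>\<^sub>E {..<m}"
  define sq where "sq x = (\<Sum>i<d. (x i)\<^sup>2)" for x :: "nat \<Rightarrow> nat"
  \<comment> \<open>Digits below \<open>m\<close> in base \<open>4 * m\<close>: sums of four do not
    carry, so the equation holds digit by digit.\<close>
  define val where "val x = (\<Sum>i<d. x i * (4 * m) ^ i)" for x :: "nat \<Rightarrow> nat"
  have sq_range: "sq \<in> ?V \<rightarrow> {..<d * m\<^sup>2}"
  proof
    fix x assume x: "x \<in> ?V"
    have "sq x < (\<Sum>i<d. m\<^sup>2)"
      unfolding sq_def using x d by (intro sum_strict_mono) (auto simp: PiE_iff intro!: power_strict_mono)
    then show "sq x \<in> {..<d * m\<^sup>2}" by simp
  qed
  have "{..<d * m\<^sup>2} \<noteq> {}" using m d by (auto simp: lessThan_empty_iff)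
  \<comment> \<open>Pigeonhole over the squared radius: some sphere carries at least the average
    number of lattice points.\<close>
  from pigeonhole_card[OF sq_range _ _ this] obtain r
    where r: "card (sq -` {r} \<inter> ?V) * card {..<d * m\<^sup>2} \<ge> card ?V" by (auto simp: finite_PiE)
  let ?X = "sq -` {r} \<inter> ?V"
  have dig: "x i < m" if "x \<in> ?X" "i < d" for x i using that by (auto simp: PiE_iff)
  have inj: "inj_on val ?X"
  proof (rule inj_onI)
    fix x y assume xy: "x \<in> ?X" "y \<in> ?X" "val x = val y"
    have b: "x i < 4 * m" "y i < 4 * m" if "i < d" for i
      using dig[OF xy(1) that] dig[OF xy(2) that] by auto
    have "\<forall>i<d. x i = y i" using xy(3) b unfolding val_def by (intro digits_unique) auto
    then show "x = y" using xy by (intro PiE_ext[of x "{..<d}" "\<lambda>_. {..<m}" y]) auto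
  qed
  have "card ?V = m ^ d" by (simp add: card_PiE)
  then have size: "m ^ d \<le> card (val ` ?X) * (d * m\<^sup>2)" using r by (simp add: card_image[OF inj])
  have sub: "val ` ?X \<subseteq> {..<(4 * m) ^ d}"
  proof
    fix v assume "v \<in> val ` ?X"
    then obtain x where x: "x \<in> ?X" "v = val x" by blast
    have "x i < 4 * m" if "i < d" for i using dig[OF x(1) that] by simp
    then show "v \<in> {..<(4 * m) ^ d}" unfolding x(2) val_def lessThan_iff by (rule digits_less)
  qed
  have sphere: "val x1 = val x2"
    if x: "x1 \<in> ?X" "x2 \<in> ?X" "x3 \<in> ?X" "x4 \<in> ?X" "x5 \<in> ?X"
      and eq: "val x1 + val x2 + val x3 + val x4 = 4 * val x5" for x1 x2 x3 x4 x5
  proof -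
    have "(\<Sum>i<d. (x1 i + x2 i + x3 i + x4 i) * (4 * m) ^ i) = (\<Sum>i<d. (4 * x5 i) * (4 * m) ^ i)"
      using eq unfolding val_def by (simp add: sum.distrib distrib_right sum_distrib_left mult.assoc)
    then have digeq: "\<forall>i<d. x1 i + x2 i + x3 i + x4 i = 4 * x5 i"
    proof (rule digits_unique[rotated 2])
      fix i assume i: "i < d"
      show "x1 i + x2 i + x3 i + x4 i < 4 * m" "4 * x5 i < 4 * m"
        using dig[OF x(1) i] dig[OF x(2) i] dig[OF x(3) i] dig[OF x(4) i] dig[OF x(5) i] by auto
    qed
    define D where "D x i = (int (x i) - int (x5 i))\<^sup>2" for x i
    have sqr: "(\<Sum>i<d. (int (x i))\<^sup>2) = int r" if "x \<in> ?X" for x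
    proof -
      have "int (sq x) = int r" using that by simp
      then show ?thesis by (simp add: sq_def)
    qed
    \<comment> \<open>As \<open>x5\<close> is the mean of the other four, the squared distances to
      it add up to their squared norms minus four times that of \<open>x5\<close>, which is 0 on a
      common sphere.\<close>
    have "(\<Sum>i<d. D x1 i + D x2 i + D x3 i + D x4 i) =
        (\<Sum>i<d. (int (x1 i))\<^sup>2 + (int (x2 i))\<^sup>2 + (int (x3 i))\<^sup>2 + (int (x4 i))\<^sup>2 - 4 * (int (x5 i))\<^sup>2)"
    proof (rule sum.cong[OF refl])
      fix i assume "i \<in> {..<d}"
      then have "int (x1 i) + int (x2 i) + int (x3 i) + int (x4 i) = 4 * int (x5 i)"
        using digeq by (metis lessThan_iff of_nat_add of_nat_mult of_nat_numeral)
      then have x1: "int (x1 i) = 4 * int (x5 i) - int (x2 i) - int (x3 i) - int (x4 i)" by simp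
      show "D x1 i + D x2 i + D x3 i + D x4 i =
        (int (x1 i))\<^sup>2 + (int (x2 i))\<^sup>2 + (int (x3 i))\<^sup>2 + (int (x4 i))\<^sup>2 - 4 * (int (x5 i))\<^sup>2"
        unfolding D_def x1 by (simp add: power2_eq_square algebra_simps)
    qed
    also have "\<dots> = 0"
      unfolding sum.distrib sum_subtractf sum_distrib_left[symmetric]
        sqr[OF x(1)] sqr[OF x(2)] sqr[OF x(3)] sqr[OF x(4)] sqr[OF x(5)] by simp
    finally have zero: "(\<Sum>i<d. D x1 i + D x2 i + D x3 i + D x4 i) = 0" .
    have nn: "0 \<le> D x i" for x i by (simp add: D_def)
    have "D x1 i + D x2 i + D x3 i + D x4 i = 0" if "i < d" for i
      using zero that nn by (subst (asm) sum_nonneg_eq_0_iff) auto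
    then have "D x1 i = 0 \<and> D x2 i = 0" if "i < d" for i
      using nn[of x1 i] nn[of x2 i] nn[of x3 i] nn[of x4 i] that by (smt (verit))
    then have "x1 i = x2 i" if "i < d" for i using that by (simp add: D_def)
    then show ?thesis by (simp add: val_def)
  qed
  have "y1 = y2" if y: "y1 \<in> val ` ?X" "y2 \<in> val ` ?X" "y3 \<in> val ` ?X" "y4 \<in> val ` ?X" "y5 \<in> val ` ?X"
    and eq: "y1 + y2 + y3 + y4 = 4 * y5" for y1 y2 y3 y4 y5
  proof -
    obtain x1 x2 x3 x4 x5 where x: "x1 \<in> ?X" "x2 \<in> ?X" "x3 \<in> ?X" "x4 \<in> ?X" "x5 \<in> ?X"
      and v: "y1 = val x1" "y2 = val x2" "y3 = val x3" "y4 = val x4" "y5 = val x5"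
      using y by (elim imageE)
    show ?thesis unfolding v by (rule sphere[OF x]) (use eq in \<open>simp only: v\<close>)
  qed
  then show ?thesis
    by (intro exI[of _ "val ` ?X"] conjI sub size ballI impI)
qed

text \<open>A fixed dimension \<open>d\<close> with \<open>3 / d \<le> \<epsilon>\<close> suffices
  for a power loss. With \<open>q = p powr (1 / d)\<close> and \<open>m\<close> about
  \<open>q / 4\<close>, pigeonhole yields \<open>q ^ (d - 2)\<close> up to a factor depending on
  \<open>d\<close>; a third power of \<open>q\<close> absorbs this factor.\<close>

lemma behrend_four_avg_asymptotic:
  assumes \<epsilon>: "0 < (\<epsilon>::real)"
  shows "\<forall>\<^sub>F p::nat in sequentially. \<exists>T\<subseteq>{..<p}. real p powr (1 - \<epsilon>) \<le> card T \<and>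
    (\<forall>x1\<in>T. \<forall>x2\<in>T. \<forall>x3\<in>T. \<forall>x4\<in>T. \<forall>x5\<in>T. x1 + x2 + x3 + x4 = 4 * x5 \<longrightarrow> x1 = x2)"
proof -
  obtain d0 :: nat where d0: "3 / \<epsilon> < real d0" using reals_Archimedean2 by blast
  define d where "d = d0 + 3"
  have d: "3 \<le> d" "3 / real d \<le> \<epsilon>"
  proof -
    show "3 \<le> d" by (simp add: d_def)
    have "3 / \<epsilon> \<le> real d" using d0 by (simp add: d_def)
    then show "3 / real d \<le> \<epsilon>" using \<epsilon> \<open>3 \<le> d\<close> by (simp add: field_simps)
  qed
  have "filterlim (\<lambda>p::nat. real p powr (1 / real d)) at_top sequentially"
    using d by real_asymp
  then have "\<forall>\<^sub>F p::nat in sequentially. max 8 (real d * 8 ^ (d - 2)) \<le> real p powr (1 / real d)"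
    unfolding filterlim_at_top by blast
  then show ?thesis
    using eventually_gt_at_top[of 0]
  proof eventually_elim
    case (elim p)
    define q where "q = real p powr (1 / real d)"
    have q: "8 \<le> q" "real d * 8 ^ (d - 2) \<le> q" using elim by (auto simp: q_def)
    have qd: "q ^ d = real p" using elim d by (simp add: q_def powr_realpow[symmetric] powr_powr)
    define m where "m = nat \<lfloor>q / 4\<rfloor>"
    have m: "real m \<le> q / 4" "q / 8 \<le> real m" using q unfolding m_def by linarith+
    have m0: "0 < m" using m q by (metis divide_pos_pos less_le_trans of_nat_0_less_iff zero_less_numeral order.strict_trans2)
    obtain T where T: "T \<subseteq> {..<(4 * m) ^ d}" "m ^ d \<le> card T * (d * m\<^sup>2)"
      "\<forall>x1\<in>T. \<forall>x2\<in>T. \<forall>x3\<in>T. \<forall>x4\<in>T. \<forall>x5\<in>T. x1 + x2 + x3 + x4 = 4 * x5 \<longrightarrow> x1 = x2"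
      using behrend_four_avg[OF m0, of d] d by auto
    have "(4 * real m) ^ d \<le> q ^ d" using m by (intro power_mono) auto
    then have "real ((4 * m) ^ d) \<le> real p" using qd by simp
    then have "(4 * m) ^ d \<le> p" by (simp only: of_nat_le_iff)
    then have sub: "T \<subseteq> {..<p}" using T(1) by (meson lessThan_subset_iff order_trans)
    have "real (m ^ (d - 2)) \<le> real (card T * d)"
    proof -
      have "d - 2 + 2 = d" using d by simp
      then have "m ^ d = m ^ (d - 2) * m\<^sup>2" by (metis power_add)
      then have "m ^ (d - 2) * m\<^sup>2 \<le> (card T * d) * m\<^sup>2" using T(2) by (simp add: mult_ac)
      then have "m ^ (d - 2) \<le> card T * d" using m0 by simp
      then show ?thesis by (simp only: of_nat_le_iff)
    qed
    then have low: "real m ^ (d - 2) \<le> real (card T) * real d" by simp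
    have "q ^ (d - 3) * (real d * 8 ^ (d - 2)) \<le> q ^ (d - 3) * q" using q by (intro mult_left_mono) auto
    also have "\<dots> = q ^ (d - 2)"
    proof -
      have "d - 2 = Suc (d - 3)" using d by simp
      then show ?thesis by simp
    qed
    finally have "q ^ (d - 3) * real d \<le> (q / 8) ^ (d - 2)" by (simp add: power_divide field_simps)
    also have "\<dots> \<le> real m ^ (d - 2)" using m q by (intro power_mono) auto
    also note low
    finally have "q ^ (d - 3) \<le> real (card T)" using d by simp
    moreover have "real p powr (1 - \<epsilon>) \<le> q ^ (d - 3)"
    proof -
      have "q ^ (d - 3) = real p powr (1 / real d * real (d - 3))"
        using elim q by (simp add: q_def powr_realpow[symmetric] powr_powr)
      also have "1 / real d * real (d - 3) = 1 - 3 / real d" using d by (simp add: field_simps of_nat_diff)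
      finally show ?thesis using d elim by (simp add: powr_mono)
    qed
    ultimately show ?case using sub T(3) by (intro exI[of _ T]) auto
  qed
qed

section \<open>Primes and the lower bound\<close>

text \<open>Passing from \<open>n\<close> to \<open>n + 1\<close> raises \<open>n div d\<close>
  exactly for the divisors \<open>d\<close> of \<open>n + 1\<close>, whose \<open>mangoldt\<close>
  values add up to \<open>ln (n + 1)\<close>. The bound \<open>M\<close> is separate from
  \<open>n\<close> so that two factorials can be expanded over one range.\<close>

lemma ln_fact_mangoldt:
  assumes "n \<le> M"
  shows "ln (fact n :: real) = (\<Sum>d=1..M. mangoldt d * real (n div d))"
  using assms
proof (induction n)
  case (Suc n)
  have step: "real (Suc n div d) = real (n div d) + (if d dvd Suc n then 1 else 0)" for d
    by (simp add: div_Suc dvd_eq_mod_eq_0)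
  have "(\<Sum>d=1..M. mangoldt d * real (Suc n div d)) =
      (\<Sum>d=1..M. mangoldt d * real (n div d)) + (\<Sum>d=1..M. if d dvd Suc n then mangoldt d else 0)"
    unfolding step distrib_left sum.distrib by (intro arg_cong2[where f = "(+)"] refl sum.cong) auto
  also have "(\<Sum>d=1..M. if d dvd Suc n then mangoldt d else 0) = (\<Sum>d | d dvd Suc n. mangoldt d :: real)"
  proof -
    have "{d. d dvd Suc n} = {1..M} \<inter> {d. d dvd Suc n}"
    proof (intro equalityI subsetI)
      fix d assume d: "d \<in> {d. d dvd Suc n}"
      then have "d \<le> Suc n" "d \<noteq> 0" by (auto dest: dvd_imp_le intro!: Nat.gr0I)
      then show "d \<in> {1..M} \<inter> {d. d dvd Suc n}" using d Suc.prems by auto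
    qed auto
    then show ?thesis by (simp add: sum.If_cases)
  qed
  also have "\<dots> = ln (real (Suc n))" by (subst mangoldt_sum) auto
  finally show ?case using Suc by (simp add: ln_mult)
qed simp

text \<open>Chebyshev's argument: in the logarithm of the central binomial coefficient each
  \<open>mangoldt d\<close> has the coefficient \<open>2 * n div d - 2 * (n div d)\<close>, which is
  0 or 1.\<close>

lemma mangoldt_sum_ge:
  assumes "0 < n"
  shows "real n * ln 4 - ln (2 * real n) \<le> (\<Sum>d=1..2 * n. mangoldt d :: real)"
proof -
  have n_le: "n \<le> 2 * n" by simp
  have "real n * ln 4 - ln (2 * real n) = ln (4 ^ n / (2 * real n))"
    using assms by (simp add: ln_div ln_realpow)
  also have "\<dots> \<le> ln (real ((2 * n) choose n))"
    using central_binomial_lower_bound[OF assms] assms by (subst ln_le_cancel_iff) auto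
  also have "real ((2 * n) choose n) = fact (2 * n) / (fact n * fact n)"
    by (simp add: binomial_fact mult_2)
  also have "ln \<dots> = ln (fact (2 * n)) - 2 * ln (fact n)"
    by (simp add: ln_div ln_mult)
  also have "\<dots> = (\<Sum>d=1..2 * n. mangoldt d * (real (2 * n div d) - 2 * real (n div d)))"
    unfolding ln_fact_mangoldt[OF order_refl, of "2 * n"] ln_fact_mangoldt[OF n_le]
      sum_distrib_left sum_subtractf[symmetric] by (intro sum.cong) (auto simp: algebra_simps)
  also have "\<dots> \<le> (\<Sum>d=1..2 * n. mangoldt d * 1)"
  proof (intro sum_mono mult_left_mono mangoldt_nonneg)
    fix d assume d: "d \<in> {1..2 * n}"
    have "2 * n div d < 2 * (n div d) + 2"
    proof -
      have "n < (n div d + 1) * d" using d dividend_less_div_times[of d n] by simp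
      then have "2 * n < (2 * (n div d) + 2) * d" by (simp add: algebra_simps)
      then show ?thesis using d by (simp add: div_less_iff_less_mult)
    qed
    then show "real (2 * n div d) - 2 * real (n div d) \<le> 1" by linarith
  qed
  finally show ?thesis by simp
qed

text \<open>A bound \<open>y\<close> for all primes up to \<open>x\<close> leaves few prime powers:
  the base is at most \<open>y\<close>, the exponent at most logarithmic, and each has weight at
  most \<open>ln x\<close>.\<close>

lemma mangoldt_sum_le:
  fixes x y :: nat
  assumes x: "1 \<le> x" and primes: "\<And>p. prime p \<Longrightarrow> p \<le> x \<Longrightarrow> p \<le> y"
  shows "(\<Sum>d=1..x. mangoldt d :: real) \<le> real y * (log 2 x + 1) * ln x"
proof -
  define K where "K = nat \<lfloor>log 2 x\<rfloor>"
  let ?P = "{d \<in> {1..x}. primepow d}"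
  have "?P \<subseteq> (\<lambda>(p, k). p ^ k) ` ({1..y} \<times> {1..Suc K})"
  proof
    fix d assume d: "d \<in> ?P"
    then obtain p k where p: "prime p" "0 < k" "d = p ^ k" by (auto simp: primepow_def)
    have p2: "2 \<le> p" using p(1) by (rule prime_ge_2_nat)
    have "p ^ 1 \<le> p ^ k" using p p2 by (intro power_increasing) auto
    then have "p \<le> x" using d p by simp
    then have py: "p \<le> y" using primes p by blast
    have "2 ^ k \<le> p ^ k" using p2 by (intro power_mono) auto
    then have "2 ^ k \<le> x" by (rule order_trans) (use d p in auto)
    then have "real (2 ^ k) \<le> real x" by (simp only: of_nat_le_iff)
    then have "real k \<le> log 2 x" using x by (simp add: le_log_iff powr_realpow)
    then have "k \<le> Suc K" unfolding K_def by linarith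
    then show "d \<in> (\<lambda>(p, k). p ^ k) ` ({1..y} \<times> {1..Suc K})"
      using p p2 py by (intro image_eqI[of _ _ "(p, k)"]) auto
  qed
  then have "card ?P \<le> card ((\<lambda>(p, k). p ^ k) ` ({1..y} \<times> {1..Suc K}))"
    by (intro card_mono) auto
  also have "\<dots> \<le> card ({1..y} \<times> {1..Suc K})" by (intro card_image_le) auto
  also have "\<dots> = y * Suc K" by (simp add: card_cartesian_product)
  finally have "real (card ?P) \<le> real (y * Suc K)" by (simp only: of_nat_le_iff)
  also have "\<dots> \<le> real y * (log 2 x + 1)"
  proof -
    have "0 \<le> log 2 x" using x by simp
    then have "real (Suc K) \<le> log 2 x + 1" unfolding K_def by simp
    then show ?thesis by (simp only: of_nat_mult mult_left_mono of_nat_0_le_iff)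
  qed
  finally have card: "real (card ?P) \<le> real y * (log 2 x + 1)" .
  have "(\<Sum>d=1..x. mangoldt d :: real) = (\<Sum>d\<in>?P. mangoldt d)"
    by (rule sum.mono_neutral_right) (auto simp: mangoldt_def)
  also have "\<dots> \<le> (\<Sum>d\<in>?P. ln x)"
  proof (rule sum_mono)
    fix d assume d: "d \<in> ?P"
    then have "mangoldt d \<le> ln (real d)" by (intro mangoldt_le) auto
    also have "\<dots> \<le> ln (real x)" using d by (subst ln_le_cancel_iff) auto
    finally show "mangoldt d \<le> ln (real x)" .
  qed
  also have "\<dots> \<le> real y * (log 2 x + 1) * ln x" using card x by (simp add: mult_right_mono)
  finally show ?thesis .
qed

text \<open>If all primes up to \<open>x\<close> were below \<open>x powr (1 - \<epsilon>)\<close>,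
  the \<open>mangoldt\<close> sum would be at most this power times two logarithms, against a linear
  lower bound.\<close>

lemma exists_prime_powr_le:
  assumes \<epsilon>: "0 < (\<epsilon>::real)" "\<epsilon> < 1"
  shows "\<forall>\<^sub>F x::nat in sequentially. \<exists>p. prime p \<and> p \<le> x \<and> real x powr (1 - \<epsilon>) \<le> real p"
proof -
  have "\<forall>\<^sub>F x::nat in sequentially.
      real x powr (1 - \<epsilon>) * (log 2 (real x) + 1) * ln (real x) < (real x - 1) / 2 * ln 4 - ln (real x)"
    using \<epsilon> by real_asymp
  then show ?thesis
    using eventually_ge_at_top[of 2]
  proof eventually_elim
    case (elim x)
    show ?case
    proof (rule ccontr)
      assume none: "\<not> ?case"
      define y where "y = nat \<lfloor>real x powr (1 - \<epsilon>)\<rfloor>"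
      have yx: "real y \<le> real x powr (1 - \<epsilon>)" unfolding y_def by simp
      have primes: "p \<le> y" if "prime p" "p \<le> x" for p
      proof -
        have "real p < real x powr (1 - \<epsilon>)" using none that by auto
        then show ?thesis unfolding y_def by linarith
      qed
      define n where "n = x div 2"
      have n: "0 < n" "2 * n \<le> x" "(real x - 1) / 2 \<le> real n"
      proof -
        show "0 < n" "2 * n \<le> x" using elim unfolding n_def by auto
        have "x \<le> 2 * n + 1" unfolding n_def by presburger
        then have "real x \<le> 2 * real n + 1" by linarith
        then show "(real x - 1) / 2 \<le> real n" by (simp add: field_simps)
      qed
      have "(real x - 1) / 2 * ln 4 - ln x \<le> real n * ln 4 - ln (2 * real n)"
      proof (intro diff_mono mult_right_mono)
        show "ln (2 * real n) \<le> ln (real x)" using n by (subst ln_le_cancel_iff) auto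
      qed (use n in auto)
      also have "\<dots> \<le> (\<Sum>d=1..2 * n. mangoldt d :: real)" by (rule mangoldt_sum_ge[OF n(1)])
      also have "\<dots> \<le> (\<Sum>d=1..x. mangoldt d :: real)"
        using n by (intro sum_mono2) (auto intro: mangoldt_nonneg)
      also have "\<dots> \<le> real y * (log 2 x + 1) * ln x" using elim by (intro mangoldt_sum_le primes) auto
      also have "\<dots> \<le> real x powr (1 - \<epsilon>) * (log 2 x + 1) * ln x"
        using elim by (intro mult_right_mono yx) auto
      finally show False using elim by simp
    qed
  qed
qed

text \<open>The Erdos--Turan set in base \<open>4 * p\<close> rather than \<open>2 * p\<close>, so that sums of four
  elements do not carry.\<close>

lemma erdos_turan_sidon:
  fixes p :: nat and T :: "nat set"
  assumes p: "prime p" "2 < p" and T: "T \<subseteq> {..<p}"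
    and avg: "\<forall>x1\<in>T. \<forall>x2\<in>T. \<forall>x3\<in>T. \<forall>x4\<in>T. \<forall>x5\<in>T. x1 + x2 + x3 + x4 = 4 * x5 \<longrightarrow> x1 = x2"
    and n: "4 * p\<^sup>2 \<le> n"
  shows "card T \<le> S n"
proof -
  define P where "P = int p"
  define r where "r k = (int k)\<^sup>2 mod P" for k
  define a where "a k = 4 * P * int k + r k + 1" for k
  have P: "2 < P" "prime P" using p by (auto simp: P_def)
  have r: "0 \<le> r k" "r k < P" for k using P by (auto simp: r_def)
  have split: "u = u' \<and> v = v'" if "4 * P * u + v = 4 * P * u' + v'" "0 \<le> v" "v < 4 * P" "0 \<le> v'" "v' < 4 * P"
    for u v u' v'
  proof -
    have "(v + 4 * P * u) div (4 * P) = u + v div (4 * P)" "(v' + 4 * P * u') div (4 * P) = u' + v' div (4 * P)"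
      using P by (intro div_mult_self2; simp)+
    moreover have "v div (4 * P) = 0" "v' div (4 * P) = 0" using that by (auto intro: div_pos_pos_trivial)
    ultimately have "(4 * P * u + v) div (4 * P) = u" "(4 * P * u' + v') div (4 * P) = u'"
      by (simp_all only: add.commute add_0)
    then have "u = u'" using that(1) by simp
    then show ?thesis using that(1) by simp
  qed
  have inj: "inj a"
  proof (rule injI)
    fix k l assume "a k = a l"
    then have "4 * P * int k + r k = 4 * P * int l + r l" by (simp add: a_def)
    from split[OF this] show "k = l" using r[of k] r[of l] P by simp
  qed
  have sub: "a ` T \<subseteq> {1..int n}"
  proof
    fix z assume "z \<in> a ` T"
    then obtain k where k: "k < p" "z = a k" using T by auto
    have "4 * P * int k \<le> 4 * P * (P - 1)" using k P by (intro mult_left_mono) (auto simp: P_def)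
    then have "a k \<le> 4 * P * (P - 1) + P" using r[of k] unfolding a_def by linarith
    also have "\<dots> \<le> 4 * P\<^sup>2" using P by (simp add: power2_eq_square algebra_simps)
    also have "\<dots> \<le> int n" 
    proof -
      have "int (4 * p\<^sup>2) \<le> int n" using n by (simp only: of_nat_le_iff)
      then show ?thesis by (simp add: P_def)
    qed
    finally have "a k \<le> int n" .
    moreover have "1 \<le> a k" using r[of k] P by (simp add: a_def)
    ultimately show "z \<in> {1..int n}" using k by simp
  qed
  have dvd0: "i = j" if "P dvd int i - int j" "i < p" "j < p" for i j :: nat
    using that dvd_imp_le_int[of "int i - int j" P] by (cases "i = j") (auto simp: P_def)
  have "sidon (a ` T)"
    unfolding sidon_def
  proof (clarify)
    fix k1 k2 k3 k4 assume k: "k1 \<in> T" "k2 \<in> T" "k3 \<in> T" "k4 \<in> T" and eq: "a k1 + a k2 = a k3 + a k4"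
    have "4 * P * (int k1 + int k2) + (r k1 + r k2) = 4 * P * (int k3 + int k4) + (r k3 + r k4)"
      using eq by (simp add: a_def algebra_simps)
    from split[OF this] have s: "int k1 + int k2 = int k3 + int k4" "r k1 + r k2 = r k3 + r k4"
      using r[of k1] r[of k2] r[of k3] r[of k4] P by auto
    have "((int k1)\<^sup>2 + (int k2)\<^sup>2) mod P = ((int k3)\<^sup>2 + (int k4)\<^sup>2) mod P"
      using s(2) unfolding r_def by (metis mod_add_eq)
    then have "P dvd ((int k1)\<^sup>2 + (int k2)\<^sup>2) - ((int k3)\<^sup>2 + (int k4)\<^sup>2)" by (simp add: mod_eq_dvd_iff)
    \<comment> \<open>The high digits add up exactly, the squares only modulo \<open>P\<close>.
      Eliminating \<open>k2\<close> by the former relation factors the latter, and 2 is invertible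
      as \<open>P\<close> is odd.\<close>
    also have "((int k1)\<^sup>2 + (int k2)\<^sup>2) - ((int k3)\<^sup>2 + (int k4)\<^sup>2) =
        2 * ((int k1 - int k3) * (int k1 - int k4))"
    proof -
      have k2: "int k2 = int k3 + int k4 - int k1" using s(1) by simp
      show ?thesis unfolding k2 by (simp add: power2_eq_square algebra_simps)
    qed
    finally have "P dvd 2 \<or> P dvd int k1 - int k3 \<or> P dvd int k1 - int k4"
      using P(2) by (simp add: prime_dvd_mult_iff)
    moreover have "\<not> P dvd 2" using P zdvd_imp_le[of P 2] by auto
    ultimately have "k1 = k3 \<or> k1 = k4" using dvd0 T k by blast
    then show "{a k1, a k2} = {a k3, a k4}" using s(1) by auto
  qed
  moreover have "no_four_avg (a ` T)"
    unfolding no_four_avg_def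
  proof (clarify)
    fix k1 k2 k3 k4 k5 assume k: "k1 \<in> T" "k2 \<in> T" "k3 \<in> T" "k4 \<in> T" "k5 \<in> T"
      and dist: "distinct [a k1, a k2, a k3, a k4, a k5]" and eq: "a k1 + a k2 + a k3 + a k4 = 4 * a k5"
    have "4 * P * (int k1 + int k2 + int k3 + int k4) + (r k1 + r k2 + r k3 + r k4) =
        4 * P * (4 * int k5) + 4 * r k5"
      using eq by (simp add: a_def algebra_simps)
    from split[OF this] have "int k1 + int k2 + int k3 + int k4 = 4 * int k5"
      using r[of k1] r[of k2] r[of k3] r[of k4] r[of k5] by auto
    then have "k1 + k2 + k3 + k4 = 4 * k5" by linarith
    then have "k1 = k2" using avg k by blast
    then show False using dist by simp
  qed
  ultimately have "card (a ` T) \<le> S n" using sub by (intro S_ge)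
  then show ?thesis using card_image[OF inj_on_subset[OF inj]] by simp
qed

text \<open>The prime and the Behrend set each lose a factor \<open>1 - e\<close> in the exponent,
  which leaves \<open>(1 - e)\<^sup>2 / 2\<close>, at least \<open>1 / 2 - e\<close>. Since
  \<open>2 * e \<le> \<epsilon>\<close>, a spare factor \<open>n powr e\<close> absorbs the constant
  4.\<close>

theorem S_lower:
  assumes \<epsilon>: "0 < (\<epsilon>::real)"
  shows "\<forall>\<^sub>F n in sequentially. real n powr (1 / 2 - \<epsilon>) \<le> real (S n)"
proof -
  define e where "e = min (\<epsilon> / 2) (1 / 4)"
  have e: "0 < e" "e < 1" "2 * e \<le> \<epsilon>" using \<epsilon> by (auto simp: e_def)
  obtain p0 where p0: "\<And>p. p0 \<le> p \<Longrightarrow> \<exists>T\<subseteq>{..<p}. real p powr (1 - e) \<le> card T \<and>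
    (\<forall>x1\<in>T. \<forall>x2\<in>T. \<forall>x3\<in>T. \<forall>x4\<in>T. \<forall>x5\<in>T. x1 + x2 + x3 + x4 = 4 * x5 \<longrightarrow> x1 = x2)"
    using behrend_four_avg_asymptotic[OF e(1)] unfolding eventually_sequentially by blast
  \<comment> \<open>Primes are sought up to \<open>sqrt n / 2\<close> because
    \<open>erdos_turan_sidon\<close> asks for \<open>4 * p\<^sup>2 \<le> n\<close>.\<close>
  have "filterlim (\<lambda>n::nat. nat \<lfloor>sqrt (real n) / 2\<rfloor>) sequentially sequentially"
    by real_asymp
  then have ev1: "\<forall>\<^sub>F n::nat in sequentially. \<exists>p. prime p \<and> p \<le> nat \<lfloor>sqrt (real n) / 2\<rfloor> \<and>
      real (nat \<lfloor>sqrt (real n) / 2\<rfloor>) powr (1 - e) \<le> real p"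
    using exists_prime_powr_le[OF e(1,2)] by (rule eventually_compose_filterlim[rotated])
  have ev2: "\<forall>\<^sub>F n::nat in sequentially. 16 \<le> n" by (rule eventually_ge_at_top)
  have ev3: "\<forall>\<^sub>F n::nat in sequentially. real (max p0 3) \<le> (sqrt (real n) / 4) powr (1 - e)"
    using e by real_asymp
  have ev4: "\<forall>\<^sub>F n::nat in sequentially. 4 \<le> real n powr e"
    using e by real_asymp
  show ?thesis
    using ev1 ev2 ev3 ev4
  proof eventually_elim
    case (elim n)
    define x where "x = nat \<lfloor>sqrt (real n) / 2\<rfloor>"
    have "sqrt 16 \<le> sqrt (real n)" using elim by (intro real_sqrt_le_mono) simp
    then have s4: "4 \<le> sqrt (real n)" by simp
    have x: "real x \<le> sqrt (real n) / 2" "sqrt (real n) / 4 \<le> real x" using s4 unfolding x_def by linarith+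
    obtain p where p: "prime p" "p \<le> x" "real x powr (1 - e) \<le> real p" using elim x_def by auto
    have q: "(sqrt (real n) / 4) powr (1 - e) \<le> real p"
      using x s4 e by (intro order_trans[OF powr_mono2 p(3)]) auto
    then have pbig: "p0 \<le> p" "2 < p" using elim by linarith+
    obtain T where T: "T \<subseteq> {..<p}" "real p powr (1 - e) \<le> card T"
      "\<forall>x1\<in>T. \<forall>x2\<in>T. \<forall>x3\<in>T. \<forall>x4\<in>T. \<forall>x5\<in>T. x1 + x2 + x3 + x4 = 4 * x5 \<longrightarrow> x1 = x2"
      using p0[OF pbig(1)] by blast
    have "4 * p\<^sup>2 \<le> n"
    proof -
      have "(2 * real p)\<^sup>2 \<le> (sqrt (real n))\<^sup>2" using p x by (intro power_mono) auto
      then have "real (4 * p\<^sup>2) \<le> real n" by (simp add: power_mult_distrib)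
      then show ?thesis by (simp only: of_nat_le_iff)
    qed
    then have "card T \<le> S n" by (rule erdos_turan_sidon[OF p(1) pbig(2) T(1,3)])
    then have "real p powr (1 - e) \<le> real (S n)" using T(2) by linarith
    moreover have "((sqrt (real n) / 4) powr (1 - e)) powr (1 - e) \<le> real p powr (1 - e)"
      using q e by (intro powr_mono2) auto
    moreover have "real n powr (1 / 2 - \<epsilon>) \<le> ((sqrt (real n) / 4) powr (1 - e)) powr (1 - e)"
    proof -
      define b where "b = (1 - e) * (1 - e)"
      have "b = 1 - 2 * e + e * e" by (simp add: b_def algebra_simps)
      moreover have "0 \<le> e * e" by simp
      moreover have "b \<le> 1" unfolding b_def using e by (intro mult_le_one) auto
      ultimately have b: "1 - 2 * e \<le> b" "b \<le> 1" by linarith+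
      have n1: "1 \<le> real n" using elim by simp
      have "real n powr (1 / 2 - \<epsilon>) * 4 \<le> real n powr (1 / 2 - \<epsilon>) * real n powr e"
        using elim by (intro mult_left_mono) auto
      also have "\<dots> = real n powr (1 / 2 - \<epsilon> + e)" by (simp add: powr_add)
      also have "\<dots> \<le> real n powr (b / 2)" using n1 b e by (intro powr_mono) auto
      finally have *: "real n powr (1 / 2 - \<epsilon>) * 4 \<le> real n powr (b / 2)" .
      have "4 powr b \<le> (4::real) powr 1" using b by (intro powr_mono) auto
      then have "real n powr (1 / 2 - \<epsilon>) * 4 powr b \<le> real n powr (1 / 2 - \<epsilon>) * 4"
        by (intro mult_left_mono) auto
      also note *
      also have "real n powr (b / 2) = sqrt (real n) powr b"
        using n1 by (simp add: powr_half_sqrt[symmetric] powr_powr)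
      finally have "real n powr (1 / 2 - \<epsilon>) \<le> (sqrt (real n) / 4) powr b"
        by (simp add: powr_divide field_simps)
      then show ?thesis by (simp add: powr_powr b_def)
    qed
    ultimately show ?case by linarith
  qed
qed

theorem theorem1p14:
  shows "((\<lambda>n. real (S n) / sqrt (real n)) \<longlonglongrightarrow> 0) \<and>
         (\<forall>\<epsilon>>0. \<forall>\<^sub>F n in sequentially. real (S n) \<ge> real n powr (1/2 - \<epsilon>))"
  using S_upper S_lower by blast

end
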